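(* Let $\emptyset\neq I\subseteq\mathbb{R}$ and let $\{\varphi_k : k\in\mathbb{Z}\}$ be an orthonormal basis of $L^2(I)$. Let $a>0$ and let $L_a^\sigma$ denote the fundamental cardinal exponential spline of real order $\sigma$, where $\sigma$ is admissible for $a$. Then the following holds: (i) The family $\{L_a^\sigma(\cdot-k):k\in\mathbb{Z}\}$ is an orthonormal basis of the Hilbert space $(\mathcal{H},\langle\cdot,\cdot\rangle_{\mathcal{H}})$, where $\mathcal{H}=\mathcal{K}(L^2(I))$ and $\mathcal{K}$ is the injective integral operator $$\mathcal{K}f=\sum_{k\in\mathbb{Z}}\langle f,\varphi_k\rangle_{L^2(I)}\,L_a^\sigma(\cdot-k),\qquad f\in L^2(I).$$ (ii) Every function $f\in\mathcal{H}\cong L^2(I)$ can be recovered from its samples on the integers via $$f=\sum_{k\in\mathbb{Z}} f(k)\,L_a^\sigma(\cdot-k),$$ where the series converges absolutely and uniformly on all subsets of $\mathbb{R}$.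
   Context: For $\sigma>1$ and $q\in\mathbb{C}\setminus\{0,-1,-2,\dots\}$, $\zeta(\sigma,q):=\sum_{k=0}^\infty \frac{1}{(k+q)^\sigma}$ denotes the generalized (Hurwitz) zeta function, with principal branches of the powers. $\operatorname{Arg}$ denotes the principal value of the argument, with values in $(-\pi,\pi]$, and $\mathbb{N}=\{1,2,3,\dots\}$. For fixed $a>0$, a real number $\sigma$ is called admissible if both of the following hold: (1) $\sigma\ge \frac12+\sqrt2\,\sqrt{1+\frac{a^2}{4\pi^2}+\frac{a^4}{16\pi^4}}$; (2) $\frac{\pi}{2}(\sigma-1)+\operatorname{Arg}\left(\zeta\left(\sigma,\frac12-i\frac{a}{2\pi}\right)\right)\notin\pi\mathbb{N}$. For $a>0$ and admissible $\sigma$, the fundamental cardinal exponential spline of order $\sigma$ is $$L_a^\sigma(x) := \frac{1}{2\pi}\int_{\mathbb{R}} \frac{\left(\frac{\xi+ia}{2\pi}\right)^{-\sigma} e^{i\xi x}}{\zeta\!\left(\sigma,\frac{\xi+ia}{2\pi}\right)+e^{-i\pi\sigma}\,\zeta\!\left(\sigma,1-\frac{\xi+ia}{2\pi}\right)}\,d\xi,\qquad x\in\mathbb{R}.$$ The operator $\mathcal{K}$ is the integral operator $(\mathcal{K}f)(t)=\int_I f(x)K(x,t)\,dx$ with kernel $K(x,t)=\sum_{k\in\mathbb{Z}}L_a^\sigma(t-k)\,\overline{\varphi_k(x)}$, $x\in I$, $t\in\mathbb{R}$. The space $\mathcal{H}=\{\mathcal{K}f: f\in L^2(I)\}$ is a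 space of functions on $\mathbb{R}$, endowed with the inner product $\langle F,G\rangle_{\mathcal{H}}:=\langle f,g\rangle_{L^2(I)}$ for $F=\mathcal{K}f$, $G=\mathcal{K}g$; $\mathcal{H}\cong L^2(I)$ means isometrically isomorphic (via $\mathcal{K}$).
   Formalization: The formal theorem additionally assumes that the integral defining the spline converges absolutely; admissibility as printed does not ensure this (for order 7/2 and a near 0.73 the denominator vanishes at ξ = π, so the spline is undefined). *)

theory Defs
  imports "HOL-Analysis.Analysis"
begin

definition hurwitz_zeta :: "real \<Rightarrow> complex \<Rightarrow> complex" where
  "hurwitz_zeta \<sigma> q = (\<Sum>k. 1 / (of_nat k + q) powr of_real \<sigma>)"

definition admissible :: "real \<Rightarrow> real \<Rightarrow> bool" where
  "admissible a \<sigma> \<longleftrightarrow>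
     \<sigma> \<ge> 1 / 2 + sqrt 2 * sqrt (1 + a^2 / (4 * pi^2) + a^4 / (16 * pi^4)) \<and>
     pi / 2 * (\<sigma> - 1) + Arg (hurwitz_zeta \<sigma> (1 / 2 - \<i> * of_real (a / (2 * pi))))
       \<notin> {pi * real n | n. n \<ge> 1}"

definition spline_integrand :: "real \<Rightarrow> real \<Rightarrow> real \<Rightarrow> real \<Rightarrow> complex" where
  "spline_integrand a \<sigma> x \<xi> =
     (let q = (of_real \<xi> + \<i> * of_real a) / of_real (2 * pi)
      in q powr (- of_real \<sigma>) * exp (\<i> * of_real \<xi> * of_real x) /
         (hurwitz_zeta \<sigma> q + exp (- \<i> * of_real pi * of_real \<sigma>) * hurwitz_zeta \<sigma> (1 - q)))"

text \<open>
  The Bochner integral is \<open>0\<close> when it does not exist, so this is the intended function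
  only if the integrand is integrable for every \<open>x\<close>.
\<close>
definition fundamental_spline :: "real \<Rightarrow> real \<Rightarrow> real \<Rightarrow> complex" where
  "fundamental_spline a \<sigma> x = 1 / of_real (2 * pi) * (LINT \<xi>|lborel. spline_integrand a \<sigma> x \<xi>)"

text \<open>
  Spaces of complex-valued functions with pointwise operations. \<open>L\<^sup>2(I)\<close> is represented by
  functions rather than classes: values outside \<open>I\<close> are irrelevant, equality is equality almost
  everywhere on \<open>I\<close>, and \<open>l2_inner\<close> is positive definite only up to that equality.
\<close>
definition l2_space :: "real set \<Rightarrow> (real \<Rightarrow> complex) set" where
  "l2_space I = {f. f \<in> borel_measurable (lebesgue_on I) \<and>
                    integrable (lebesgue_on I) (\<lambda>x. (cmod (f x))\<^sup>2)}"

definition l2_inner :: "real set \<Rightarrow> (real \<Rightarrow> complex) \<Rightarrow> (real \<Rightarrow> complex) \<Rightarrow> complex" where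
  "l2_inner I f g = (LINT x|lebesgue_on I. f x * cnj (g x))"

definition ip_norm :: "(('a \<Rightarrow> complex) \<Rightarrow> ('a \<Rightarrow> complex) \<Rightarrow> complex) \<Rightarrow> ('a \<Rightarrow> complex) \<Rightarrow> real" where
  "ip_norm ip f = sqrt (Re (ip f f))"

text \<open>Orthonormality together with density of the finite linear combinations.\<close>
definition orthonormal_basis ::
  "('a \<Rightarrow> complex) set \<Rightarrow> (('a \<Rightarrow> complex) \<Rightarrow> ('a \<Rightarrow> complex) \<Rightarrow> complex)
     \<Rightarrow> ('k \<Rightarrow> 'a \<Rightarrow> complex) \<Rightarrow> bool" where
  "orthonormal_basis V ip e \<longleftrightarrow>
     (\<forall>k. e k \<in> V) \<and>
     (\<forall>j k. ip (e j) (e k) = (if j = k then 1 else 0)) \<and>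
     (\<forall>f\<in>V. \<forall>\<epsilon>>0. \<exists>A c. finite A \<and> ip_norm ip (\<lambda>x. f x - (\<Sum>k\<in>A. c k * e k x)) < \<epsilon>)"

definition hilbert_function_space ::
  "('a \<Rightarrow> complex) set \<Rightarrow> (('a \<Rightarrow> complex) \<Rightarrow> ('a \<Rightarrow> complex) \<Rightarrow> complex) \<Rightarrow> bool" where
  "hilbert_function_space V ip \<longleftrightarrow>
     (\<lambda>x. 0) \<in> V \<and>
     (\<forall>f\<in>V. \<forall>g\<in>V. (\<lambda>x. f x + g x) \<in> V) \<and>
     (\<forall>c. \<forall>f\<in>V. (\<lambda>x. c * f x) \<in> V) \<and>
     (\<forall>f\<in>V. \<forall>g\<in>V. \<forall>h\<in>V. ip (\<lambda>x. f x + g x) h = ip f h + ip g h) \<and>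
     (\<forall>c. \<forall>f\<in>V. \<forall>g\<in>V. ip (\<lambda>x. c * f x) g = c * ip f g) \<and>
     (\<forall>f\<in>V. \<forall>g\<in>V. ip g f = cnj (ip f g)) \<and>
     (\<forall>f\<in>V. 0 \<le> Re (ip f f) \<and> (ip f f = 0 \<longrightarrow> f = (\<lambda>x. 0))) \<and>
     (\<forall>F. (\<forall>n::nat. F n \<in> V) \<and>
          (\<forall>\<epsilon>>0. \<exists>N. \<forall>m\<ge>N. \<forall>n\<ge>N. ip_norm ip (\<lambda>x. F m x - F n x) < \<epsilon>) \<longrightarrow>
          (\<exists>f\<in>V. (\<lambda>n. ip_norm ip (\<lambda>x. F n x - f x)) \<longlonglongrightarrow> 0))"

definition spline_kernel ::
  "real \<Rightarrow> real \<Rightarrow> (int \<Rightarrow> real \<Rightarrow> complex) \<Rightarrow> real \<Rightarrow> real \<Rightarrow> complex" where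
  "spline_kernel a \<sigma> \<phi> x t = (\<Sum>\<^sub>\<infinity>k. fundamental_spline a \<sigma> (t - of_int k) * cnj (\<phi> k x))"

definition spline_operator ::
  "real \<Rightarrow> real \<Rightarrow> real set \<Rightarrow> (int \<Rightarrow> real \<Rightarrow> complex) \<Rightarrow> (real \<Rightarrow> complex) \<Rightarrow> real \<Rightarrow> complex" where
  "spline_operator a \<sigma> I \<phi> f t = (LINT x|lebesgue_on I. f x * spline_kernel a \<sigma> \<phi> x t)"

definition spline_space ::
  "real \<Rightarrow> real \<Rightarrow> real set \<Rightarrow> (int \<Rightarrow> real \<Rightarrow> complex) \<Rightarrow> (real \<Rightarrow> complex) set" where
  "spline_space a \<sigma> I \<phi> = spline_operator a \<sigma> I \<phi> ` l2_space I"

definition spline_inner ::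
  "real \<Rightarrow> real \<Rightarrow> real set \<Rightarrow> (int \<Rightarrow> real \<Rightarrow> complex)
     \<Rightarrow> (real \<Rightarrow> complex) \<Rightarrow> (real \<Rightarrow> complex) \<Rightarrow> complex" where
  "spline_inner a \<sigma> I \<phi> F G =
     (THE c. \<exists>f\<in>l2_space I. \<exists>g\<in>l2_space I.
        F = spline_operator a \<sigma> I \<phi> f \<and> G = spline_operator a \<sigma> I \<phi> g \<and> c = l2_inner I f g)"

end

theory Submission
  imports Defs "HOL-Complex_Analysis.Complex_Analysis"
begin

text \<open>
  On the upper half-plane the denominator of the integrand is \<open>D(q) = \<Sum>n\<in>\<int>. (q + n) powr -\<sigma>\<close>,
  a holomorphic function of period 1. It has no zero on the line of integration: a zero would
  destroy the integrability of the integrand. By periodicity and compactness \<open>D\<close> is bounded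
  away from zero on a strip around that line, so Cauchy's inequality bounds the derivatives of the
  integrand by multiples of the integrand itself, and two integrations by parts give
  \<open>L(x) = O(1 / (1 + x\<^sup>2))\<close>. Hence \<open>\<Sum>k. \<bar>L(t - k)\<bar>\<close> is bounded uniformly in \<open>t\<close>. The integer
  translates of the Fourier transform of \<open>L\<close> sum to 1, so \<open>L(j)\<close> is 1 for \<open>j = 0\<close> and 0 for
  the other integers \<open>j\<close>. It follows that \<open>K f(j) = \<langle>f, \<phi>\<^sub>j\<rangle>\<close> and \<open>\<bar>K f(t)\<bar> \<le> M \<parallel>f\<parallel>\<close>, and everything
  else is transported from \<open>L\<^sup>2(I)\<close> by \<open>K\<close>.
\<close>

subsection \<open>Square-integrable functions\<close>

text \<open>Interpolation does more than produce samples. As the value of \<open>K f\<close> at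
  \<open>j\<close> is the \<open>j\<close>-th coefficient of \<open>f\<close>, the operator is
  injective up to null sets, and this makes \<open>spline_inner\<close>, a definite description over
  preimages, well defined. The bound on \<open>K f\<close> by the norm of \<open>f\<close> makes
  evaluation at a point continuous, so that expansions converging in norm converge uniformly on the
  whole line. Elements of L2(I) are functions rather than classes: almost-everywhere equality is
  carried along on that side, whereas equality in \<open>H\<close> is pointwise. Likewise the kernel
  is controlled only for almost every \<open>x\<close>. The factor
  \<open>exp (- \<i> * pi * \<sigma>)\<close> in the denominator is the change of branch between
  powers of \<open>q\<close> and of \<open>- q\<close> on the upper half-plane; with it, two
  one-sided Hurwitz series join to a two-sided one. Bounds for the denominator are needed on a strip
  and not only on the line because Cauchy's inequality works with discs.\<close>

lemma borel_measurable_cnj [measurable (raw)]: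
  "f \<in> borel_measurable M \<Longrightarrow> (\<lambda>x. cnj (f x)) \<in> borel_measurable M"
  by (rule borel_measurable_continuous_on[OF linear_continuous_on[OF bounded_linear_cnj]])

lemma l2_spaceD:
  assumes "f \<in> l2_space I"
  shows "f \<in> borel_measurable (lebesgue_on I)"
    and "integrable (lebesgue_on I) (\<lambda>x. (cmod (f x))\<^sup>2)"
  using assms by (auto simp: l2_space_def)

lemma l2_integrable_mult_cnj:
  assumes f: "f \<in> l2_space I" and g: "g \<in> l2_space I"
  shows "integrable (lebesgue_on I) (\<lambda>x. f x * cnj (g x))"
proof (rule Bochner_Integration.integrable_bound)
  note [measurable] = l2_spaceD(1)[OF f] l2_spaceD(1)[OF g]
  show "integrable (lebesgue_on I) (\<lambda>x. (cmod (f x))\<^sup>2 + (cmod (g x))\<^sup>2)"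
    using l2_spaceD(2)[OF f] l2_spaceD(2)[OF g] by simp
  show "(\<lambda>x. f x * cnj (g x)) \<in> borel_measurable (lebesgue_on I)"
    by measurable
  have "cmod (f x * cnj (g x)) \<le> (cmod (f x))\<^sup>2 + (cmod (g x))\<^sup>2" for x
    unfolding norm_mult complex_mod_cnj
    using sum_squares_bound[of "cmod (f x)" "cmod (g x)"]
      mult_nonneg_nonneg[OF norm_ge_zero[of "f x"] norm_ge_zero[of "g x"]]
    by linarith
  then show "AE x in lebesgue_on I. norm (f x * cnj (g x)) \<le> norm ((cmod (f x))\<^sup>2 + (cmod (g x))\<^sup>2)"
    by (auto simp: abs_of_nonneg)
qed

lemma l2_space_zero: "(\<lambda>x. 0) \<in> l2_space I"
  by (simp add: l2_space_def)

lemma l2_space_scale: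
  assumes f: "f \<in> l2_space I"
  shows "(\<lambda>x. c * f x) \<in> l2_space I"
proof -
  note [measurable] = l2_spaceD(1)[OF f]
  show ?thesis
    using l2_spaceD(2)[OF f] by (auto simp: l2_space_def norm_mult power_mult_distrib)
qed

lemma l2_space_add:
  assumes f: "f \<in> l2_space I" and g: "g \<in> l2_space I"
  shows "(\<lambda>x. f x + g x) \<in> l2_space I"
proof -
  note [measurable] = l2_spaceD(1)[OF f] l2_spaceD(1)[OF g]
  have "integrable (lebesgue_on I) (\<lambda>x. (cmod (f x + g x))\<^sup>2)"
  proof (rule Bochner_Integration.integrable_bound)
    show "integrable (lebesgue_on I) (\<lambda>x. 2 * (cmod (f x))\<^sup>2 + 2 * (cmod (g x))\<^sup>2)"
      using l2_spaceD(2)[OF f] l2_spaceD(2)[OF g] by simp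
    have "(cmod (f x + g x))\<^sup>2 \<le> 2 * (cmod (f x))\<^sup>2 + 2 * (cmod (g x))\<^sup>2" for x
    proof -
      have "(cmod (f x + g x))\<^sup>2 \<le> (cmod (f x) + cmod (g x))\<^sup>2"
        by (intro power_mono norm_triangle_ineq) auto
      also have "\<dots> \<le> 2 * (cmod (f x))\<^sup>2 + 2 * (cmod (g x))\<^sup>2"
        using sum_squares_bound[of "cmod (f x)" "cmod (g x)"] by (simp add: power2_sum)
      finally show ?thesis .
    qed
    then show "AE x in lebesgue_on I. norm ((cmod (f x + g x))\<^sup>2)
        \<le> norm (2 * (cmod (f x))\<^sup>2 + 2 * (cmod (g x))\<^sup>2)"
      by (auto simp: abs_of_nonneg)
  qed measurable
  then show ?thesis by (simp add: l2_space_def)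
qed

lemma l2_space_diff:
  assumes "f \<in> l2_space I" "g \<in> l2_space I"
  shows "(\<lambda>x. f x - g x) \<in> l2_space I"
  using l2_space_add[OF assms(1) l2_space_scale[OF assms(2), of "-1"]] by simp

lemma l2_space_sum:
  assumes "finite A" "\<And>k. k \<in> A \<Longrightarrow> f k \<in> l2_space I"
  shows "(\<lambda>x. \<Sum>k\<in>A. f k x) \<in> l2_space I"
  using assms by (induction A) (auto intro: l2_space_zero l2_space_add)

lemma l2_inner_add_left:
  assumes "f \<in> l2_space I" "g \<in> l2_space I" "h \<in> l2_space I"
  shows "l2_inner I (\<lambda>x. f x + g x) h = l2_inner I f h + l2_inner I g h"
  using l2_integrable_mult_cnj[OF assms(1,3)] l2_integrable_mult_cnj[OF assms(2,3)]
  by (simp add: l2_inner_def distrib_right)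

lemma l2_inner_scale_left: "l2_inner I (\<lambda>x. c * f x) h = c * l2_inner I f h"
  by (simp add: l2_inner_def mult.assoc)

lemma l2_inner_commute: "l2_inner I g f = cnj (l2_inner I f g)"
  unfolding l2_inner_def by (subst Bochner_Integration.integral_cnj[symmetric]) (simp add: mult.commute)

lemma l2_inner_diff_left:
  assumes "f \<in> l2_space I" "g \<in> l2_space I" "h \<in> l2_space I"
  shows "l2_inner I (\<lambda>x. f x - g x) h = l2_inner I f h - l2_inner I g h"
  using l2_inner_add_left[OF assms(1) l2_space_scale[OF assms(2), of "-1"] assms(3)]
    l2_inner_scale_left[of I "-1" g h] by simp

lemma l2_inner_diff_right:
  assumes "f \<in> l2_space I" "g \<in> l2_space I" "h \<in> l2_space I"
  shows "l2_inner I h (\<lambda>x. f x - g x) = l2_inner I h f - l2_inner I h g"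
  using l2_inner_diff_left[OF assms] by (metis complex_cnj_diff l2_inner_commute)

lemma l2_inner_self:
  "l2_inner I f f = of_real (LINT x|lebesgue_on I. (cmod (f x))\<^sup>2)"
  unfolding l2_inner_def by (simp add: complex_norm_square[symmetric] flip: integral_complex_of_real)

lemma Re_l2_inner_self: "Re (l2_inner I f f) = (LINT x|lebesgue_on I. (cmod (f x))\<^sup>2)"
  by (simp add: l2_inner_self)

lemma l2_inner_self_nonneg: "0 \<le> Re (l2_inner I f f)"
  by (simp add: l2_inner_self)

lemma ip_norm_l2_power2: "(ip_norm (l2_inner I) f)\<^sup>2 = Re (l2_inner I f f)"
  by (simp add: ip_norm_def l2_inner_self_nonneg)

lemma ip_norm_l2_nonneg: "0 \<le> ip_norm (l2_inner I) f"
  by (simp add: ip_norm_def l2_inner_self_nonneg)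

lemma l2_inner_self_eq_0:
  assumes f: "f \<in> l2_space I" and 0: "Re (l2_inner I f f) = 0"
  shows "AE x in lebesgue_on I. f x = 0"
proof -
  have "AE x in lebesgue_on I. (cmod (f x))\<^sup>2 = 0"
    using 0 l2_spaceD(2)[OF f] by (subst integral_nonneg_eq_0_iff_AE[symmetric]) (auto simp: Re_l2_inner_self)
  then show ?thesis by simp
qed

lemma l2_inner_cong_AE:
  assumes "f \<in> l2_space I" "f' \<in> l2_space I" "g \<in> l2_space I" "g' \<in> l2_space I"
    and "AE x in lebesgue_on I. f x = f' x" "AE x in lebesgue_on I. g x = g' x"
  shows "l2_inner I f g = l2_inner I f' g'"
  unfolding l2_inner_def
proof (rule integral_cong_AE)
  show "(\<lambda>x. f x * cnj (g x)) \<in> borel_measurable (lebesgue_on I)"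
    "(\<lambda>x. f' x * cnj (g' x)) \<in> borel_measurable (lebesgue_on I)"
    using assms(1-4)[THEN l2_integrable_mult_cnj] assms(3,4) by auto
  show "AE x in lebesgue_on I. f x * cnj (g x) = f' x * cnj (g' x)"
    using assms(5,6) by eventually_elim simp
qed

text \<open>Completing the square in \<open>c\<close>: among the multiples of a unit vector the
  nearest to \<open>f\<close> has the factor \<open>l2_inner I f e\<close>. This is one step of the
  induction behind \<open>norm_diff_comb\<close>.\<close>

lemma l2_norm_diff_unit:
  assumes f: "f \<in> l2_space I" and e: "e \<in> l2_space I" and 1: "l2_inner I e e = 1"
  shows "Re (l2_inner I (\<lambda>x. f x - c * e x) (\<lambda>x. f x - c * e x))
       = Re (l2_inner I f f) - (cmod (l2_inner I f e))\<^sup>2 + (cmod (c - l2_inner I f e))\<^sup>2"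
proof -
  let ?ce = "\<lambda>x. c * e x"
  note ce = l2_space_scale[OF e, of c]
  have "l2_inner I f ?ce = cnj c * l2_inner I f e"
    by (metis complex_cnj_mult l2_inner_commute l2_inner_scale_left)
  moreover have "l2_inner I ?ce ?ce = c * cnj c"
    by (metis 1 complex_cnj_mult complex_cnj_one l2_inner_commute l2_inner_scale_left mult.right_neutral)
  moreover have "l2_inner I ?ce f = c * cnj (l2_inner I f e)"
    by (simp add: l2_inner_scale_left l2_inner_commute[of I e f])
  ultimately have "l2_inner I (\<lambda>x. f x - c * e x) (\<lambda>x. f x - c * e x)
      = l2_inner I f f - cnj c * l2_inner I f e - (c * cnj (l2_inner I f e) - c * cnj c)"
    using f ce by (simp add: l2_inner_diff_left l2_inner_diff_right l2_space_diff)
  then have "Re (l2_inner I (\<lambda>x. f x - c * e x) (\<lambda>x. f x - c * e x))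
      = Re (l2_inner I f f - cnj c * l2_inner I f e - (c * cnj (l2_inner I f e) - c * cnj c))"
    by simp
  then show ?thesis
    unfolding cmod_power2 by (simp add: power2_eq_square algebra_simps)
qed

text \<open>The Riesz-Fischer argument: a rapidly Cauchy subsequence converges almost everywhere,
  and Fatou's lemma bounds the distance of the whole sequence from its limit.\<close>

lemma Cauchy_l2_converges:
  assumes F: "\<And>n. F n \<in> l2_space I"
    and Cauchy: "\<And>e. e > 0 \<Longrightarrow> \<exists>N. \<forall>m\<ge>N. \<forall>n\<ge>N. ip_norm (l2_inner I) (\<lambda>x. F m x - F n x) < e"
  obtains f where "f \<in> l2_space I" "(\<lambda>n. ip_norm (l2_inner I) (\<lambda>x. F n x - f x)) \<longlonglongrightarrow> 0"
proof -
  note [measurable] = l2_spaceD(1)[OF F]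
  define M where "M = lebesgue_on I"
  define d where "d m n = (LINT x|M. (cmod (F m x - F n x))\<^sup>2)" for m n
  have d_int: "integrable M (\<lambda>x. (cmod (F m x - F n x))\<^sup>2)" for m n
    unfolding M_def by (rule l2_spaceD(2)[OF l2_space_diff[OF F F]])
  have Fm[measurable]: "F n \<in> borel_measurable M" for n
    unfolding M_def by measurable
  have ip: "ip_norm (l2_inner I) (\<lambda>x. F m x - F n x) = sqrt (d m n)" for m n
    by (simp add: ip_norm_def Re_l2_inner_self d_def M_def)
  have Cd: "\<exists>N. \<forall>m\<ge>N. \<forall>n\<ge>N. d m n < e" if "e > 0" for e
  proof -
    have "\<exists>N. \<forall>m\<ge>N. \<forall>n\<ge>N. sqrt (d m n) < sqrt e"
      using Cauchy[of "sqrt e"] that unfolding ip by simp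
    then obtain N where N: "\<And>m n. m \<ge> N \<Longrightarrow> n \<ge> N \<Longrightarrow> sqrt (d m n) < sqrt e"
      by blast
    then show ?thesis by (intro exI[of _ N]) auto
  qed
  \<comment> \<open>The rate \<open>(1/8) ^ j\<close> leaves room for the weight
    \<open>4 ^ j\<close> below: the weighted squared increments have integrals at most
    \<open>(1/2) ^ j\<close>, and once a weighted term is below 1 the increment itself is at most
    \<open>(1/2) ^ j\<close>.\<close>
  obtain r where r: "strict_mono (r :: nat \<Rightarrow> nat)" and rd: "\<And>j. d (r (Suc j)) (r j) < (1/8) ^ j"
  proof -
    have "\<exists>N. \<forall>m\<ge>N. \<forall>n\<ge>N. d m n < (1/8) ^ j" for j :: nat
      by (rule Cd) auto
    then obtain N where N: "\<And>j m n. m \<ge> N j \<Longrightarrow> n \<ge> N j \<Longrightarrow> d m n < (1/8) ^ j"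
      by metis
    define r where "r = rec_nat (N 0) (\<lambda>j p. max (Suc p) (N (Suc j)))"
    have r0: "r 0 = N 0" and rS: "r (Suc j) = max (Suc (r j)) (N (Suc j))" for j
      by (simp_all add: r_def)
    have "r j \<ge> N j" for j
      by (cases j) (auto simp: r0 rS)
    then have "d (r (Suc j)) (r j) < (1/8) ^ j" for j
      by (intro N) (auto simp: rS le_max_iff_disj less_imp_le intro: le_SucI)
    moreover have "strict_mono r"
      by (intro strict_monoI_Suc) (simp add: rS)
    ultimately show ?thesis using that by blast
  qed
  have AE_conv: "AE x in M. convergent (\<lambda>j. F (r j) x)"
  proof -
    let ?h = "\<lambda>j x. 4 ^ j * (cmod (F (r (Suc j)) x - F (r j) x))\<^sup>2"
    have "(\<integral>\<^sup>+x. (\<Sum>j. ennreal (?h j x)) \<partial>M) = (\<Sum>j. \<integral>\<^sup>+x. ennreal (?h j x) \<partial>M)"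
      by (rule nn_integral_suminf) measurable
    also have "\<dots> \<le> (\<Sum>j. ennreal ((1/2) ^ j))"
    proof (intro suminf_le)
      show "(\<integral>\<^sup>+x. ennreal (?h j x) \<partial>M) \<le> ennreal ((1/2) ^ j)" for j
      proof -
        have "(\<integral>\<^sup>+x. ennreal (?h j x) \<partial>M) = ennreal (4 ^ j * d (r (Suc j)) (r j))"
          unfolding d_def using d_int by (subst nn_integral_eq_integral) auto
        also have "\<dots> \<le> ennreal (4 ^ j * (1/8) ^ j)"
          using rd[of j] by (intro ennreal_leI mult_left_mono) auto
        also have "(4::real) ^ j * (1/8) ^ j = (1/2) ^ j"
          by (simp flip: power_mult_distrib)
        finally show ?thesis .
      qed
    qed auto
    also have "\<dots> < \<infinity>"
      by (subst suminf_ennreal2) (auto intro!: summable_geometric)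
    finally have "AE x in M. (\<Sum>j. ennreal (?h j x)) \<noteq> \<infinity>"
      by (intro nn_integral_PInf_AE) auto
    then show ?thesis
    proof eventually_elim
      case (elim x)
      let ?g = "\<lambda>j. cmod (F (r (Suc j)) x - F (r j) x)"
      have "summable (\<lambda>j. ?h j x)"
        using elim by (intro summable_suminf_not_top) auto
      then have lim: "(\<lambda>j. ?h j x) \<longlonglongrightarrow> 0" by (rule summable_LIMSEQ_zero)
      have "eventually (\<lambda>j. ?h j x < 1) sequentially"
        using order_tendstoD(2)[OF lim, of 1] by auto
      then have "eventually (\<lambda>j. norm (?g j) \<le> (1/2) ^ j) sequentially"
      proof eventually_elim
        case (elim j)
        have "(2 ^ j * ?g j)\<^sup>2 = (2 ^ j * 2 ^ j) * (?g j)\<^sup>2"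
          by (simp add: power2_eq_square)
        also have "(2::real) ^ j * 2 ^ j = 4 ^ j"
          by (simp flip: power_mult_distrib)
        finally have "(2 ^ j * ?g j)\<^sup>2 \<le> 1\<^sup>2"
          using elim by simp
        then have "2 ^ j * ?g j \<le> 1"
          by (rule power2_le_imp_le) auto
        then show ?case by (simp add: field_simps)
      qed
      then have "summable ?g"
        by (rule summable_comparison_test_ev) (auto intro!: summable_geometric)
      then have "summable (\<lambda>j. F (r (Suc j)) x - F (r j) x)"
        by (rule summable_norm_cancel)
      then have "convergent (\<lambda>n. \<Sum>j<n. F (r (Suc j)) x - F (r j) x)"
        by (simp add: summable_iff_convergent)
      then have "convergent (\<lambda>n. F (r n) x - F (r 0) x)"
        by (simp add: sum_lessThan_telescope[of "\<lambda>j. F (r j) x"])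
      then show ?case
        using convergent_add[OF _ convergent_const[of "F (r 0) x"]] by fastforce
    qed
  qed
  \<comment> \<open>On the null set where the subsequence diverges \<open>lim\<close> is an
    arbitrary value; measurability holds regardless.\<close>
  define f where "f x = lim (\<lambda>j. F (r j) x)" for x
  have f[measurable]: "f \<in> borel_measurable M"
    unfolding f_def by measurable
  \<comment> \<open>Fatou's lemma along the subsequence with \<open>n\<close> fixed. The bound lives
    in the extended reals because integrability of the left-hand side is only deduced from
    it.\<close>
  have bound: "(\<integral>\<^sup>+x. ennreal ((cmod (F n x - f x))\<^sup>2) \<partial>M) \<le> ennreal e"
    if e: "e > 0" and N: "\<And>m. m \<ge> N \<Longrightarrow> d n m < e" for n e N
  proof -
    have "(\<integral>\<^sup>+x. ennreal ((cmod (F n x - f x))\<^sup>2) \<partial>M)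
        = (\<integral>\<^sup>+x. liminf (\<lambda>j. ennreal ((cmod (F n x - F (r j) x))\<^sup>2)) \<partial>M)"
    proof (rule nn_integral_cong_AE)
      show "AE x in M. ennreal ((cmod (F n x - f x))\<^sup>2)
        = liminf (\<lambda>j. ennreal ((cmod (F n x - F (r j) x))\<^sup>2))"
        using AE_conv
      proof eventually_elim
        case (elim x)
        then have "(\<lambda>j. F (r j) x) \<longlonglongrightarrow> f x"
          unfolding f_def by (simp add: convergent_LIMSEQ_iff)
        then have "(\<lambda>j. ennreal ((cmod (F n x - F (r j) x))\<^sup>2)) \<longlonglongrightarrow> ennreal ((cmod (F n x - f x))\<^sup>2)"
          by (intro tendsto_intros)
        from lim_imp_Liminf[OF _ this] show ?case by simp
      qed
    qed
    also have "\<dots> \<le> liminf (\<lambda>j. \<integral>\<^sup>+x. ennreal ((cmod (F n x - F (r j) x))\<^sup>2) \<partial>M)"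
      by (rule nn_integral_liminf) measurable
    also have "\<dots> \<le> ennreal e"
    proof -
      have "(\<integral>\<^sup>+x. ennreal ((cmod (F n x - F (r j) x))\<^sup>2) \<partial>M) \<le> ennreal e" if "j \<ge> N" for j
      proof -
        have "(\<integral>\<^sup>+x. ennreal ((cmod (F n x - F (r j) x))\<^sup>2) \<partial>M) = ennreal (d n (r j))"
          unfolding d_def using d_int by (subst nn_integral_eq_integral) auto
        moreover have "r j \<ge> N"
          using seq_suble[OF r, of j] that by simp
        ultimately show ?thesis
          using N[of "r j"] by (auto intro: ennreal_leI)
      qed
      then have "eventually (\<lambda>j. (\<integral>\<^sup>+x. ennreal ((cmod (F n x - F (r j) x))\<^sup>2) \<partial>M) \<le> ennreal e) sequentially"
        by (auto simp: eventually_sequentially)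
      then show ?thesis
        by (intro Liminf_le) auto
    qed
    finally show ?thesis .
  qed
  have diff_int: "integrable M (\<lambda>x. (cmod (F n x - f x))\<^sup>2)"
    if e: "e > 0" and N: "\<And>m. m \<ge> N \<Longrightarrow> d n m < e" for n e N
  proof (rule integrableI_bounded)
    have "(\<integral>\<^sup>+x. ennreal ((cmod (F n x - f x))\<^sup>2) \<partial>M) \<le> ennreal e"
      by (rule bound[OF e N])
    also have "\<dots> < \<infinity>" by simp
    finally show "(\<integral>\<^sup>+x. ennreal (norm ((cmod (F n x - f x))\<^sup>2)) \<partial>M) < \<infinity>" by simp
  qed measurable
  have "f \<in> l2_space I"
  proof -
    obtain N where N: "\<And>m. m \<ge> N \<Longrightarrow> d N m < 1"
      using Cd[of 1] by (metis order_refl zero_less_one)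
    have "(\<lambda>x. F N x - f x) \<in> l2_space I"
      using diff_int[OF _ N] Fm[of N] f unfolding M_def l2_space_def by auto
    from l2_space_diff[OF F[of N] this] show ?thesis by simp
  qed
  moreover have "(\<lambda>n. ip_norm (l2_inner I) (\<lambda>x. F n x - f x)) \<longlonglongrightarrow> 0"
  proof (rule LIMSEQ_I)
    fix e :: real assume e: "e > 0"
    then have "\<exists>N. \<forall>m\<ge>N. \<forall>n\<ge>N. d m n < (e/2)\<^sup>2"
      by (intro Cd) auto
    then obtain N where N: "\<And>m n. m \<ge> N \<Longrightarrow> n \<ge> N \<Longrightarrow> d n m < (e/2)\<^sup>2"
      by blast
    have "norm (ip_norm (l2_inner I) (\<lambda>x. F n x - f x) - 0) < e" if n: "n \<ge> N" for n
    proof -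
      have e2: "(e/2)\<^sup>2 > 0" using e by simp
      note i = diff_int[OF e2 N[OF _ n]]
      have "ennreal (LINT x|M. (cmod (F n x - f x))\<^sup>2) \<le> ennreal ((e/2)\<^sup>2)"
        using bound[OF e2 N[OF _ n]] i by (subst nn_integral_eq_integral[symmetric]) auto
      then have "(ip_norm (l2_inner I) (\<lambda>x. F n x - f x))\<^sup>2 \<le> (e/2)\<^sup>2"
        by (simp add: ip_norm_l2_power2 Re_l2_inner_self M_def)
      then have "ip_norm (l2_inner I) (\<lambda>x. F n x - f x) \<le> e/2"
        by (rule power2_le_imp_le) (use e in simp)
      then show ?thesis using e ip_norm_l2_nonneg[of I "\<lambda>x. F n x - f x"] by simp
    qed
    then show "\<exists>N. \<forall>n\<ge>N. norm (ip_norm (l2_inner I) (\<lambda>x. F n x - f x) - 0) < e" by blast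
  qed
  ultimately show thesis by (rule that)
qed

subsection \<open>Sampling with an absolutely summable interpolating generator\<close>

lemma summable_on_int_iff:
  fixes g :: "int \<Rightarrow> real"
  assumes "\<And>k. 0 \<le> g k"
  shows "g summable_on UNIV \<longleftrightarrow> summable (\<lambda>n. g (int_decode n))"
  using summable_on_reindex_bij_betw[OF bij_int_decode, of g]
    summable_on_UNIV_nonneg_real_iff[of "\<lambda>n. g (int_decode n)"] assms by simp

lemma has_sum_int_suminf:
  fixes g :: "int \<Rightarrow> complex"
  assumes "summable (\<lambda>n. norm (g (int_decode n)))"
  shows "(g has_sum (\<Sum>n. g (int_decode n))) UNIV"
  using norm_summable_imp_has_sum[OF assms summable_sums[OF summable_norm_cancel[OF assms]]]
    has_sum_reindex_bij_betw[OF bij_int_decode, of g] by simp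

text \<open>For complex numbers unordered summability is absolute summability, so
  \<open>infsum\<close> falls back to its default value 0 exactly when the norms are not
  summable.\<close>

lemma infsum_int_eq_suminf:
  fixes g :: "int \<Rightarrow> complex"
  shows "infsum g UNIV = (if summable (\<lambda>n. norm (g (int_decode n))) then (\<Sum>n. g (int_decode n)) else 0)"
  using has_sum_int_suminf[of g] summable_on_int_iff[of "\<lambda>k. norm (g k)"]
  by (auto simp: infsum_not_exists summable_on_iff_abs_summable_on_complex intro: infsumI)

text \<open>The set where the default value is taken is measurable, because summability of the norms
  says that a series of extended nonnegative reals differs from \<open>top\<close>.\<close>

lemma borel_measurable_infsum_int:
  fixes g :: "int \<Rightarrow> 'a \<Rightarrow> complex"
  assumes [measurable]: "\<And>k. g k \<in> borel_measurable N"
  shows "(\<lambda>x. \<Sum>\<^sub>\<infinity>k. g k x) \<in> borel_measurable N"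
proof -
  have "summable (\<lambda>n. norm (g (int_decode n) x)) \<longleftrightarrow> (\<Sum>n. ennreal (norm (g (int_decode n) x))) \<noteq> top" for x
    by (metis ennreal_suminf_neq_top norm_ge_zero summable_suminf_not_top)
  then show ?thesis
    unfolding infsum_int_eq_suminf by simp
qed

text \<open>What the sampling argument asks of the spline: interpolation at the integers and
  absolute sums of translates bounded independently of \<open>t\<close>. The Fourier analysis of
  \<open>L\<close> thus stays separate from the transport of L2(I).\<close>

locale spline_sampling =
  fixes a \<sigma> :: real and I :: "real set" and \<phi> :: "int \<Rightarrow> real \<Rightarrow> complex" and M :: real
  assumes onb: "orthonormal_basis (l2_space I) (l2_inner I) \<phi>"
    and L_int: "\<And>j. fundamental_spline a \<sigma> (of_int j) = (if j = 0 then 1 else 0)"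
    and L_summable: "\<And>t. (\<lambda>k. norm (fundamental_spline a \<sigma> (t - of_int k))) summable_on UNIV"
    and L_bound: "\<And>t. (\<Sum>\<^sub>\<infinity>k. norm (fundamental_spline a \<sigma> (t - of_int k))) \<le> M"
begin

abbreviation "L \<equiv> fundamental_spline a \<sigma>"
abbreviation "K \<equiv> spline_operator a \<sigma> I \<phi>"
abbreviation "H \<equiv> spline_space a \<sigma> I \<phi>"
abbreviation "ipH \<equiv> spline_inner a \<sigma> I \<phi>"

lemma phi_l2: "\<phi> k \<in> l2_space I"
  and phi_inner: "l2_inner I (\<phi> j) (\<phi> k) = (if j = k then 1 else 0)"
  and phi_dense: "f \<in> l2_space I \<Longrightarrow> \<epsilon> > 0 \<Longrightarrow>
    \<exists>A c. finite A \<and> ip_norm (l2_inner I) (\<lambda>x. f x - (\<Sum>k\<in>A. c k * \<phi> k x)) < \<epsilon>"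
  using onb by (auto simp: orthonormal_basis_def)

lemma phi_measurable [measurable]: "\<phi> k \<in> borel_measurable (lebesgue_on I)"
  by (rule l2_spaceD(1)[OF phi_l2])

lemma comb_l2: "finite A \<Longrightarrow> (\<lambda>x. \<Sum>k\<in>A. c k * \<phi> k x) \<in> l2_space I"
  by (intro l2_space_sum l2_space_scale phi_l2)

lemma phi_integral: "(LINT x|lebesgue_on I. (cmod (\<phi> k x))\<^sup>2) = 1"
  using phi_inner[of k k] by (simp add: l2_inner_self)

lemma inner_comb_phi:
  assumes "finite A"
  shows "l2_inner I (\<lambda>x. \<Sum>k\<in>A. c k * \<phi> k x) (\<phi> j) = (if j \<in> A then c j else 0)"
  using assms
proof (induction A)
  case (insert i A)
  then show ?case
    using l2_inner_add_left[OF l2_space_scale[OF phi_l2[of i], of "c i"] comb_l2[of A c] phi_l2[of j]]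
    by (simp add: l2_inner_scale_left phi_inner) auto
qed (simp add: l2_inner_def)

text \<open>A new basis vector is orthogonal to the earlier ones, so the remainder has the same
  coefficient as \<open>f\<close> there and \<open>l2_norm_diff_unit\<close> applies again. The
  coefficients of \<open>f\<close> are therefore the best choice of \<open>c\<close>, and
  nonnegativity of the left-hand side yields Bessel's inequality.\<close>

lemma norm_diff_comb:
  assumes f: "f \<in> l2_space I" and "finite A"
  shows "Re (l2_inner I (\<lambda>x. f x - (\<Sum>k\<in>A. c k * \<phi> k x)) (\<lambda>x. f x - (\<Sum>k\<in>A. c k * \<phi> k x)))
    = Re (l2_inner I f f) - (\<Sum>k\<in>A. (cmod (l2_inner I f (\<phi> k)))\<^sup>2)
      + (\<Sum>k\<in>A. (cmod (c k - l2_inner I f (\<phi> k)))\<^sup>2)"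
  using assms(2)
proof (induction A)
  case (insert i A)
  let ?g = "\<lambda>x. f x - (\<Sum>k\<in>A. c k * \<phi> k x)"
  have g: "?g \<in> l2_space I"
    by (intro l2_space_diff f comb_l2 insert)
  have "l2_inner I ?g (\<phi> i) = l2_inner I f (\<phi> i)"
    using insert by (simp add: l2_inner_diff_left[OF f comb_l2 phi_l2] inner_comb_phi)
  then show ?case
    using l2_norm_diff_unit[OF g phi_l2[of i], of "c i"] insert
    by (simp add: phi_inner algebra_simps)
qed simp

lemma coeff_bound:
  assumes "f \<in> l2_space I"
  shows "cmod (l2_inner I f (\<phi> k)) \<le> ip_norm (l2_inner I) f"
proof -
  have "0 \<le> Re (l2_inner I f f) - (cmod (l2_inner I f (\<phi> k)))\<^sup>2"
    using norm_diff_comb[OF assms, of "{k}" "\<lambda>k. l2_inner I f (\<phi> k)"]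
      l2_inner_self_nonneg[of I "\<lambda>x. f x - (\<Sum>j\<in>{k}. l2_inner I f (\<phi> j) * \<phi> j x)"]
    by simp
  then show ?thesis
    by (simp add: ip_norm_def real_le_rsqrt)
qed

text \<open>Density supplies one good combination over a finite \<open>A\<close>; by
  \<open>norm_diff_comb\<close> the partial sum with the coefficients of \<open>f\<close> over any
  finite \<open>B\<close> containing \<open>A\<close> is at least as good. Hence convergence along
  the net of finite sets, not just along one enumeration.\<close>

lemma l2_expansion_converges:
  assumes f: "f \<in> l2_space I"
  shows "((\<lambda>A. ip_norm (l2_inner I) (\<lambda>x. f x - (\<Sum>k\<in>A. l2_inner I f (\<phi> k) * \<phi> k x))) \<longlongrightarrow> 0)
    (finite_subsets_at_top UNIV)"
proof (rule tendstoI)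
  fix \<epsilon> :: real assume "\<epsilon> > 0"
  then obtain A c where A: "finite A"
    and c: "ip_norm (l2_inner I) (\<lambda>x. f x - (\<Sum>k\<in>A. c k * \<phi> k x)) < \<epsilon>"
    using phi_dense[OF f] by blast
  have "ip_norm (l2_inner I) (\<lambda>x. f x - (\<Sum>k\<in>B. l2_inner I f (\<phi> k) * \<phi> k x)) < \<epsilon>"
    if B: "finite B" "A \<subseteq> B" for B
  proof -
    have "(\<Sum>k\<in>A. (cmod (l2_inner I f (\<phi> k)))\<^sup>2) \<le> (\<Sum>k\<in>B. (cmod (l2_inner I f (\<phi> k)))\<^sup>2)"
      using B by (intro sum_mono2) auto
    moreover have "0 \<le> (\<Sum>k\<in>A. (cmod (c k - l2_inner I f (\<phi> k)))\<^sup>2)"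
      by (intro sum_nonneg) auto
    ultimately have "ip_norm (l2_inner I) (\<lambda>x. f x - (\<Sum>k\<in>B. l2_inner I f (\<phi> k) * \<phi> k x))
        \<le> ip_norm (l2_inner I) (\<lambda>x. f x - (\<Sum>k\<in>A. c k * \<phi> k x))"
      unfolding ip_norm_def by (intro real_sqrt_le_mono) (simp add: norm_diff_comb[OF f] A B)
    with c show ?thesis by simp
  qed
  then show "\<forall>\<^sub>F A in finite_subsets_at_top UNIV.
      dist (ip_norm (l2_inner I) (\<lambda>x. f x - (\<Sum>k\<in>A. l2_inner I f (\<phi> k) * \<phi> k x))) 0 < \<epsilon>"
    using A by (auto simp: eventually_finite_subsets_at_top ip_norm_l2_nonneg)
qed

lemma l2_coeffs_eq_0:
  assumes f: "f \<in> l2_space I" and 0: "\<And>k. l2_inner I f (\<phi> k) = 0"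
  shows "AE x in lebesgue_on I. f x = 0"
proof -
  have "((\<lambda>A::int set. ip_norm (l2_inner I) f) \<longlongrightarrow> 0) (finite_subsets_at_top UNIV)"
    using l2_expansion_converges[OF f] by (simp add: 0)
  then have "ip_norm (l2_inner I) f = 0"
    by (simp add: tendsto_const_iff)
  then show ?thesis
    using l2_inner_self_eq_0[OF f] by (simp add: ip_norm_def)
qed

section \<open>The kernel and termwise integration\<close>

lemma AE_kernel_abs_summable:
  "AE x in lebesgue_on I. (\<lambda>k. norm (L (t - of_int k) * cnj (\<phi> k x))) summable_on UNIV"
proof -
  define c where "c k = norm (L (t - of_int k))" for k :: int
  have c: "summable (\<lambda>n. c (int_decode n))" and c0: "\<And>k. 0 \<le> c k"
    using L_summable[of t] summable_on_int_iff[of c] by (auto simp: c_def[abs_def])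
  \<comment> \<open>Squares, because each \<open>\<phi> k\<close> has norm one in L2(I) while it
    need not be integrable itself when \<open>I\<close> has infinite measure.\<close>
  let ?h = "\<lambda>n x. c (int_decode n) * (cmod (\<phi> (int_decode n) x))\<^sup>2"
  have "(\<integral>\<^sup>+x. (\<Sum>n. ennreal (?h n x)) \<partial>lebesgue_on I) = (\<Sum>n. \<integral>\<^sup>+x. ennreal (?h n x) \<partial>lebesgue_on I)"
    by (rule nn_integral_suminf) measurable
  also have "\<dots> = (\<Sum>n. ennreal (c (int_decode n)))"
    using l2_spaceD(2)[OF phi_l2] c0
    by (intro suminf_cong, subst nn_integral_eq_integral) (auto simp: phi_integral)
  also have "\<dots> < \<infinity>"
    using c c0 by (simp add: suminf_ennreal2)
  finally have "AE x in lebesgue_on I. (\<Sum>n. ennreal (?h n x)) \<noteq> \<infinity>"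
    by (intro nn_integral_PInf_AE) auto
  then show ?thesis
  proof eventually_elim
    case (elim x)
    have "summable (\<lambda>n. ?h n x)"
      using elim c0 by (intro summable_suminf_not_top) auto
    then have "summable (\<lambda>n. c (int_decode n) + ?h n x)"
      by (intro summable_add c)
    moreover have "norm (L (t - of_int k) * cnj (\<phi> k x)) \<le> c k + c k * (cmod (\<phi> k x))\<^sup>2" for k
    proof -
      \<comment> \<open>This returns from squares to first powers: the constant 1 is absorbed by the
        summability of \<open>c\<close>, the square by that of \<open>?h\<close>.\<close>
      have "cmod (\<phi> k x) \<le> 1 + (cmod (\<phi> k x))\<^sup>2"
        using sum_squares_bound[of 1 "cmod (\<phi> k x)"] norm_ge_zero[of "\<phi> k x"]
        by (simp del: norm_ge_zero)
      then show ?thesis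
        using mult_left_mono[OF _ c0[of k]] by (force simp: c_def norm_mult algebra_simps)
    qed
    ultimately show ?case
      by (subst summable_on_int_iff) (auto intro: summable_comparison_test')
  qed
qed

lemma kernel_measurable [measurable]:
  "(\<lambda>x. spline_kernel a \<sigma> \<phi> x t) \<in> borel_measurable (lebesgue_on I)"
  unfolding spline_kernel_def by (rule borel_measurable_infsum_int) measurable

lemma
  assumes f: "f \<in> l2_space I"
  shows integrable_kernel: "integrable (lebesgue_on I) (\<lambda>x. f x * spline_kernel a \<sigma> \<phi> x t)"
    and operator_has_sum: "((\<lambda>k. l2_inner I f (\<phi> k) * L (t - of_int k)) has_sum K f t) UNIV"
proof -
  note [measurable] = l2_spaceD(1)[OF f]
  define u where "u n x = L (t - of_int (int_decode n)) * (f x * cnj (\<phi> (int_decode n) x))" for n x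
  have c: "summable (\<lambda>n. norm (L (t - of_int (int_decode n))))"
    using L_summable[of t] by (subst (asm) summable_on_int_iff) auto
  \<comment> \<open>The summand 1 is the squared norm of \<open>\<phi> k\<close>. As
    \<open>B\<close> does not depend on \<open>k\<close>, summability of the translates suffices for
    exchanging sum and integral.\<close>
  define B where "B = Re (l2_inner I f f) + 1"
  have B: "(LINT x|lebesgue_on I. norm (f x * cnj (\<phi> k x))) \<le> B" for k
  proof -
    have "(LINT x|lebesgue_on I. norm (f x * cnj (\<phi> k x)))
        \<le> (LINT x|lebesgue_on I. (cmod (f x))\<^sup>2 + (cmod (\<phi> k x))\<^sup>2)"
    proof (rule integral_mono)
      show "norm (f x * cnj (\<phi> k x)) \<le> (cmod (f x))\<^sup>2 + (cmod (\<phi> k x))\<^sup>2" for x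
        unfolding norm_mult complex_mod_cnj
        using sum_squares_bound[of "cmod (f x)" "cmod (\<phi> k x)"]
          mult_nonneg_nonneg[OF norm_ge_zero[of "f x"] norm_ge_zero[of "\<phi> k x"]]
        by linarith
    qed (use l2_spaceD(2)[OF f] l2_spaceD(2)[OF phi_l2] l2_integrable_mult_cnj[OF f phi_l2] in auto)
    also have "\<dots> = B"
      using l2_spaceD(2)[OF f] l2_spaceD(2)[OF phi_l2] by (simp add: B_def Re_l2_inner_self phi_integral)
    finally show ?thesis .
  qed
  have B_bound: "summable (\<lambda>n. LINT x|lebesgue_on I. norm (u n x))"
  proof (rule summable_comparison_test')
    show "summable (\<lambda>n. norm (L (t - of_int (int_decode n))) * B)"
      by (rule summable_mult2[OF c])
    show "norm (LINT x|lebesgue_on I. norm (u n x)) \<le> norm (L (t - of_int (int_decode n))) * B" for n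
      using mult_left_mono[OF B norm_ge_zero] by (simp add: u_def norm_mult)
  qed
  have ui: "integrable (lebesgue_on I) (u n)" for n
    unfolding u_def by (intro integrable_mult_right l2_integrable_mult_cnj f phi_l2)
  have AE: "AE x in lebesgue_on I. summable (\<lambda>n. norm (u n x)) \<and> (\<Sum>n. u n x) = f x * spline_kernel a \<sigma> \<phi> x t"
    using AE_kernel_abs_summable[of t]
  proof eventually_elim
    case (elim x)
    then have s: "summable (\<lambda>n. norm (L (t - of_int (int_decode n)) * cnj (\<phi> (int_decode n) x)))"
      by (subst (asm) summable_on_int_iff) auto
    have u: "u n x = f x * (L (t - of_int (int_decode n)) * cnj (\<phi> (int_decode n) x))" for n
      by (simp add: u_def)
    show ?case
      unfolding u spline_kernel_def infsum_int_eq_suminf norm_mult[of "f x"]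
      using s by (auto intro!: summable_mult suminf_mult dest: summable_norm_cancel)
  qed
  then have AEs: "AE x in lebesgue_on I. summable (\<lambda>n. norm (u n x))" by eventually_elim simp
  note ints = integrable_suminf[OF ui AEs B_bound] integral_suminf[OF ui AEs B_bound]
  show i: "integrable (lebesgue_on I) (\<lambda>x. f x * spline_kernel a \<sigma> \<phi> x t)"
    by (rule integrable_cong_AE_imp[OF ints(1)]) (use AE in \<open>auto\<close>)
  have "K f t = (LINT x|lebesgue_on I. (\<Sum>n. u n x))"
    unfolding spline_operator_def
    using ints(1) i AE by (intro integral_cong_AE) auto
  also have "\<dots> = (\<Sum>n. l2_inner I f (\<phi> (int_decode n)) * L (t - of_int (int_decode n)))"
    unfolding ints(2) by (simp add: u_def[abs_def] l2_inner_def mult.commute)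
  finally have K: "K f t = (\<Sum>n. l2_inner I f (\<phi> (int_decode n)) * L (t - of_int (int_decode n)))" .
  have "summable (\<lambda>n. norm (l2_inner I f (\<phi> (int_decode n)) * L (t - of_int (int_decode n))))"
  proof (rule summable_comparison_test')
    show "summable (\<lambda>n. ip_norm (l2_inner I) f * norm (L (t - of_int (int_decode n))))"
      by (rule summable_mult[OF c])
    show "norm (norm (l2_inner I f (\<phi> (int_decode n)) * L (t - of_int (int_decode n))))
        \<le> ip_norm (l2_inner I) f * norm (L (t - of_int (int_decode n)))" for n
      using mult_right_mono[OF coeff_bound[OF f] norm_ge_zero] by (simp add: norm_mult)
  qed
  then show "((\<lambda>k. l2_inner I f (\<phi> k) * L (t - of_int k)) has_sum K f t) UNIV"
    unfolding K by (rule has_sum_int_suminf[of "\<lambda>k. l2_inner I f (\<phi> k) * L (t - of_int k)"])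
qed

text \<open>At an integer all translates but one vanish. Injectivity of \<open>K\<close> and the
  sampling series both rest on this.\<close>

lemma operator_int:
  assumes f: "f \<in> l2_space I"
  shows "K f (of_int j) = l2_inner I f (\<phi> j)"
proof -
  have "((\<lambda>k. l2_inner I f (\<phi> k) * L (of_int j - of_int k)) has_sum l2_inner I f (\<phi> j)) UNIV"
    by (rule has_sum_finite_neutralI[of "{j}"])
       (use L_int[of 0] in \<open>auto simp: L_int simp flip: of_int_diff\<close>)
  with operator_has_sum[OF f, of "of_int j"] show ?thesis
    by (rule has_sum_unique)
qed

text \<open>Bessel's inequality bounds each coefficient by the norm of \<open>f\<close>, and
  \<open>M\<close> bounds the remaining sum of translates. Independence of \<open>t\<close> is what
  later turns norm convergence into uniform convergence.\<close>

lemma operator_bound: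
  assumes f: "f \<in> l2_space I"
  shows "norm (K f t) \<le> M * ip_norm (l2_inner I) f"
proof -
  have "norm (K f t) \<le> (\<Sum>\<^sub>\<infinity>k. ip_norm (l2_inner I) f * norm (L (t - of_int k)))"
  proof (rule norm_infsum_le[OF operator_has_sum[OF f]])
    show "((\<lambda>k. ip_norm (l2_inner I) f * norm (L (t - of_int k))) has_sum
      (\<Sum>\<^sub>\<infinity>k. ip_norm (l2_inner I) f * norm (L (t - of_int k)))) UNIV"
      by (intro has_sum_infsum summable_on_cmult_right L_summable)
    show "norm (l2_inner I f (\<phi> k) * L (t - of_int k)) \<le> ip_norm (l2_inner I) f * norm (L (t - of_int k))" for k
      using mult_right_mono[OF coeff_bound[OF f] norm_ge_zero] by (simp add: norm_mult)
  qed
  also have "\<dots> = ip_norm (l2_inner I) f * (\<Sum>\<^sub>\<infinity>k. norm (L (t - of_int k)))"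
    by (rule infsum_cmult_right) (rule L_summable)
  also have "\<dots> \<le> ip_norm (l2_inner I) f * M"
    by (intro mult_left_mono L_bound ip_norm_l2_nonneg)
  finally show ?thesis by (simp add: mult.commute)
qed

lemma operator_phi: "K (\<phi> k) t = L (t - of_int k)"
proof -
  have "((\<lambda>j. l2_inner I (\<phi> k) (\<phi> j) * L (t - of_int j)) has_sum L (t - of_int k)) UNIV"
    by (rule has_sum_finite_neutralI[of "{k}"]) (auto simp: phi_inner)
  with operator_has_sum[OF phi_l2[of k], of t] show ?thesis
    by (rule has_sum_unique)
qed

lemma operator_add:
  assumes "f \<in> l2_space I" "g \<in> l2_space I"
  shows "K (\<lambda>x. f x + g x) = (\<lambda>t. K f t + K g t)"
  unfolding spline_operator_def
  using integrable_kernel[OF assms(1)] integrable_kernel[OF assms(2)]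
  by (intro ext) (simp add: distrib_right)

lemma operator_scale: "K (\<lambda>x. c * f x) = (\<lambda>t. c * K f t)"
  unfolding spline_operator_def by (simp add: mult.assoc)

lemma operator_diff:
  assumes "f \<in> l2_space I" "g \<in> l2_space I"
  shows "K (\<lambda>x. f x - g x) = (\<lambda>t. K f t - K g t)"
  unfolding spline_operator_def
  using integrable_kernel[OF assms(1)] integrable_kernel[OF assms(2)]
  by (intro ext) (simp add: left_diff_distrib)

lemma operator_zero: "K (\<lambda>x. 0) = (\<lambda>t. 0)"
  by (rule ext) (simp add: spline_operator_def)

lemma operator_comb:
  assumes "finite A"
  shows "K (\<lambda>x. \<Sum>k\<in>A. c k * \<phi> k x) = (\<lambda>t. \<Sum>k\<in>A. c k * L (t - of_int k))"
  using assms
proof (induction A)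
  case (insert i A)
  then show ?case
    using operator_add[OF l2_space_scale[OF phi_l2[of i], of "c i"] comb_l2[of A c]]
    by (simp add: operator_scale operator_phi)
qed (simp add: operator_zero)

lemma operator_diff_comb:
  assumes "f \<in> l2_space I" "finite A"
  shows "(\<lambda>t. K f t - (\<Sum>k\<in>A. c k * L (t - of_int k))) = K (\<lambda>x. f x - (\<Sum>k\<in>A. c k * \<phi> k x))"
  using operator_diff[OF assms(1) comb_l2[OF assms(2)]] operator_comb[OF assms(2)] by metis

lemma operator_inj:
  assumes "f \<in> l2_space I" "g \<in> l2_space I" "K f = K g"
  shows "AE x in lebesgue_on I. f x = g x"
proof -
  have "AE x in lebesgue_on I. f x - g x = 0"
  proof (rule l2_coeffs_eq_0)
    show "l2_inner I (\<lambda>x. f x - g x) (\<phi> k) = 0" for k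
      using operator_int[OF assms(1), of k] operator_int[OF assms(2), of k] assms
      by (simp add: l2_inner_diff_left phi_l2)
  qed (intro l2_space_diff assms)
  then show ?thesis by simp
qed

section \<open>The inner product on the image and the transport of the Hilbert space
  structure\<close>

lemma ipH_operator:
  assumes f: "f \<in> l2_space I" and g: "g \<in> l2_space I"
  shows "ipH (K f) (K g) = l2_inner I f g"
  unfolding spline_inner_def
proof (rule the_equality)
  fix c
  assume "\<exists>f'\<in>l2_space I. \<exists>g'\<in>l2_space I. K f = K f' \<and> K g = K g' \<and> c = l2_inner I f' g'"
  then obtain f' g' where *: "f' \<in> l2_space I" "g' \<in> l2_space I" "K f = K f'" "K g = K g'"
    "c = l2_inner I f' g'" by blast
  \<comment> \<open>By injectivity other preimages differ from \<open>f\<close> and \<open>g\<close>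
    only on null sets, which the inner product does not see.\<close>
  show "c = l2_inner I f g"
    unfolding *(5)
    using operator_inj[OF *(1) f *(3)[symmetric]] operator_inj[OF *(2) g *(4)[symmetric]]
    by (intro l2_inner_cong_AE * f g)
qed (use f g in blast)

lemma ip_norm_operator:
  assumes "f \<in> l2_space I"
  shows "ip_norm ipH (K f) = ip_norm (l2_inner I) f"
  by (simp add: ip_norm_def ipH_operator assms)

lemma H_iff: "F \<in> H \<longleftrightarrow> (\<exists>f\<in>l2_space I. F = K f)"
  by (auto simp: spline_space_def)

lemma operator_expansion_converges:
  assumes f: "f \<in> l2_space I"
  shows "((\<lambda>A. ip_norm ipH (\<lambda>t. K f t - (\<Sum>k\<in>A. l2_inner I f (\<phi> k) * L (t - of_int k)))) \<longlongrightarrow> 0)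
    (finite_subsets_at_top UNIV)"
proof (rule Lim_transform_eventually[OF l2_expansion_converges[OF f]])
  show "\<forall>\<^sub>F A in finite_subsets_at_top UNIV.
      ip_norm (l2_inner I) (\<lambda>x. f x - (\<Sum>k\<in>A. l2_inner I f (\<phi> k) * \<phi> k x))
    = ip_norm ipH (\<lambda>t. K f t - (\<Sum>k\<in>A. l2_inner I f (\<phi> k) * L (t - of_int k)))"
    by (rule eventually_finite_subsets_at_top_weakI)
       (simp add: operator_diff_comb ip_norm_operator f l2_space_diff comb_l2)
qed

lemma hilbert_H: "hilbert_function_space H ipH"
  unfolding hilbert_function_space_def
proof (intro conjI ballI allI impI)
  show "(\<lambda>x. 0) \<in> H"
    unfolding H_iff using operator_zero l2_space_zero by metis
next
  fix F G assume "F \<in> H" "G \<in> H"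
  then obtain f g where fg: "f \<in> l2_space I" "g \<in> l2_space I" "F = K f" "G = K g"
    by (auto simp: H_iff)
  show "(\<lambda>x. F x + G x) \<in> H"
    unfolding fg operator_add[OF fg(1,2), symmetric] using l2_space_add[OF fg(1,2)] by (auto simp: H_iff)
  show "(\<lambda>x. c * F x) \<in> H" for c
    unfolding fg operator_scale[symmetric] using l2_space_scale[OF fg(1)] by (auto simp: H_iff)
  show "ipH (\<lambda>x. c * F x) G = c * ipH F G" for c
    unfolding fg operator_scale[symmetric]
    by (simp add: ipH_operator fg l2_space_scale l2_inner_scale_left)
  show "ipH G F = cnj (ipH F G)"
    unfolding fg by (simp add: ipH_operator fg flip: l2_inner_commute)
  show "0 \<le> Re (ipH F F)"
    unfolding fg by (simp add: ipH_operator fg l2_inner_self_nonneg)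
  \<comment> \<open>Vanishing at every point, and not merely almost everywhere, comes from the
    pointwise bound.\<close>
  show "F = (\<lambda>x. 0)" if "ipH F F = 0"
  proof (rule ext)
    fix t
    have "ip_norm (l2_inner I) f = 0"
      using that unfolding fg by (simp add: ipH_operator fg ip_norm_def)
    then show "F t = 0"
      using operator_bound[OF fg(1), of t] by (simp add: fg)
  qed
  fix R assume "R \<in> H"
  then obtain h where h: "h \<in> l2_space I" "R = K h"
    by (auto simp: H_iff)
  show "ipH (\<lambda>x. F x + G x) R = ipH F R + ipH G R"
    unfolding fg h operator_add[OF fg(1,2), symmetric]
    by (simp add: ipH_operator fg h l2_space_add l2_inner_add_left)
next
  fix F assume F: "(\<forall>n::nat. F n \<in> H) \<and>
    (\<forall>\<epsilon>>0. \<exists>N. \<forall>m\<ge>N. \<forall>n\<ge>N. ip_norm ipH (\<lambda>x. F m x - F n x) < \<epsilon>)"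
  then obtain u where u: "\<And>n. u n \<in> l2_space I" "\<And>n. F n = K (u n)"
    unfolding H_iff by metis
  have diff: "ip_norm ipH (\<lambda>x. F m x - K v x) = ip_norm (l2_inner I) (\<lambda>x. u m x - v x)"
    if "v \<in> l2_space I" for m v
    unfolding u(2) operator_diff[OF u(1) that, symmetric]
    by (rule ip_norm_operator) (intro l2_space_diff u that)
  have "\<exists>N. \<forall>m\<ge>N. \<forall>n\<ge>N. ip_norm (l2_inner I) (\<lambda>x. u m x - u n x) < e" if "e > 0" for e
    using F that diff[OF u(1)] by (simp flip: u(2))
  then obtain f where "f \<in> l2_space I" "(\<lambda>n. ip_norm (l2_inner I) (\<lambda>x. u n x - f x)) \<longlonglongrightarrow> 0"
    using Cauchy_l2_converges[of u I] u(1) by blast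
  then show "\<exists>f\<in>H. (\<lambda>n. ip_norm ipH (\<lambda>x. F n x - f x)) \<longlonglongrightarrow> 0"
    by (intro bexI[of _ "K f"]) (auto simp: diff H_iff)
qed

lemma basis_H: "orthonormal_basis H ipH (\<lambda>k t. L (t - of_int k))"
proof -
  have Lk: "(\<lambda>t. L (t - of_int k)) = K (\<phi> k)" for k
    by (simp add: operator_phi fun_eq_iff)
  have "\<exists>A c. finite A \<and> ip_norm ipH (\<lambda>t. F t - (\<Sum>k\<in>A. c k * L (t - of_int k))) < \<epsilon>"
    if FH: "F \<in> H" and "\<epsilon> > 0" for F \<epsilon>
  proof -
    obtain f where f: "f \<in> l2_space I" "F = K f"
      using FH by (auto simp: H_iff)
    obtain A c where "finite A" "ip_norm (l2_inner I) (\<lambda>x. f x - (\<Sum>k\<in>A. c k * \<phi> k x)) < \<epsilon>"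
      using phi_dense[OF f(1) \<open>\<epsilon> > 0\<close>] by blast
    then show ?thesis
      unfolding f(2)
      by (intro exI[of _ A] exI[of _ c]) (simp add: operator_diff_comb ip_norm_operator f l2_space_diff comb_l2)
  qed
  then show ?thesis
    unfolding orthonormal_basis_def using phi_l2
    by (auto simp: Lk ipH_operator phi_inner H_iff)
qed

lemma samples_abs_summable:
  assumes "F \<in> H"
  shows "(\<lambda>k::int. norm (F (of_int k) * L (t - of_int k))) summable_on UNIV"
proof -
  obtain f where f: "f \<in> l2_space I" "F = K f"
    using assms by (auto simp: H_iff)
  show ?thesis
    using operator_has_sum[OF f(1), of t]
    unfolding f(2) operator_int[OF f(1)]
    by (auto simp: summable_on_iff_abs_summable_on_complex[symmetric] summable_on_def)
qed

text \<open>The remainder of the sampling series is \<open>K\<close> of the remainder of the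
  expansion in L2(I). Its values are at most \<open>M\<close> times a norm free of \<open>t\<close>,
  so one finite set serves all points of \<open>S\<close>.\<close>

lemma samples_uniform_limit:
  assumes "F \<in> H"
  shows "uniform_limit S (\<lambda>A t. \<Sum>k\<in>A. F (of_int k) * L (t - of_int k)) F
    (finite_subsets_at_top (UNIV :: int set))"
proof -
  obtain f where f: "f \<in> l2_space I" "F = K f"
    using assms by (auto simp: H_iff)
  let ?r = "\<lambda>A x. f x - (\<Sum>k\<in>A. l2_inner I f (\<phi> k) * \<phi> k x)"
  have lim: "((\<lambda>A. M * ip_norm (l2_inner I) (?r A)) \<longlongrightarrow> 0) (finite_subsets_at_top UNIV)"
    by (rule tendsto_mult_right_zero[OF l2_expansion_converges[OF f(1)]])
  show ?thesis
    unfolding uniform_limit_iff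
  proof (intro allI impI)
    fix e :: real assume "e > 0"
    have "\<forall>\<^sub>F A in finite_subsets_at_top UNIV. finite A \<and> M * ip_norm (l2_inner I) (?r A) < e"
      using order_tendstoD(2)[OF lim \<open>e > 0\<close>]
      by (intro eventually_conj) (auto intro: eventually_finite_subsets_at_top_weakI)
    then show "\<forall>\<^sub>F A in finite_subsets_at_top (UNIV :: int set).
        \<forall>t\<in>S. dist (\<Sum>k\<in>A. F (of_int k) * L (t - of_int k)) (F t) < e"
    proof eventually_elim
      case (elim A)
      have "dist (\<Sum>k\<in>A. F (of_int k) * L (t - of_int k)) (F t) = norm (K (?r A) t)" for t
        using elim f by (simp add: operator_diff_comb[symmetric] operator_int dist_norm norm_minus_commute)
      moreover have "norm (K (?r A) t) < e" for t
        using operator_bound[of "?r A" t] elim f by (auto simp: l2_space_diff comb_l2)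
      ultimately show ?case by simp
    qed
  qed
qed

end

subsection \<open>The periodized power function\<close>

text \<open>Comparison with the series of \<open>n powr -\<sigma>\<close>. The majorant is required
  only for large \<open>n\<close>, so \<open>S\<close> may contain points at which an early term is
  singular; such a term has the default value 0.\<close>

lemma hurwitz_zeta_uniform_limit:
  assumes \<sigma>: "\<sigma> > 1" and "bounded S"
  shows "uniform_limit S (\<lambda>N z. \<Sum>k<N. 1 / (of_nat k + z) powr of_real \<sigma>) (hurwitz_zeta \<sigma>) sequentially"
proof -
  obtain R where R: "\<And>z. z \<in> S \<Longrightarrow> norm z \<le> R"
    using \<open>bounded S\<close> unfolding bounded_iff by blast
  \<comment> \<open>For \<open>n \<ge> n0\<close> and \<open>z\<close> in \<open>S\<close> the
    triangle inequality gives \<open>n + z\<close> a modulus of at least \<open>n / 2\<close>, the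
    origin of the factor \<open>2 powr \<sigma>\<close>.\<close>
  obtain n0 :: nat where n0: "real n0 > max 0 (2 * R)"
    using reals_Archimedean2 by blast
  have "\<forall>\<^sub>F n in sequentially. \<forall>z\<in>S.
      norm (1 / (of_nat n + z) powr of_real \<sigma>) \<le> 2 powr \<sigma> * real n powr (-\<sigma>)"
    using eventually_ge_at_top[of n0]
  proof eventually_elim
    case (elim n)
    show ?case
    proof
      fix z assume "z \<in> S"
      have n: "real n > 0" "real n > 2 * R"
        using elim n0 by auto
      have "real n \<le> norm (of_nat n + z) + norm z"
        using norm_triangle_ineq4[of "of_nat n + z" z] by simp
      then have "real n / 2 \<le> norm (of_nat n + z)"
        using R[OF \<open>z \<in> S\<close>] n by linarith
      then have "(real n / 2) powr \<sigma> \<le> norm (of_nat n + z) powr \<sigma>"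
        using \<sigma> by (intro powr_mono2) auto
      moreover have "(real n / 2) powr \<sigma> > 0"
        using n by simp
      ultimately have "1 / norm (of_nat n + z) powr \<sigma> \<le> 1 / (real n / 2) powr \<sigma>"
        by (intro frac_le) auto
      also have "\<dots> = 2 powr \<sigma> * real n powr (-\<sigma>)"
        using n by (simp add: powr_divide powr_minus divide_simps)
      finally show "norm (1 / (of_nat n + z) powr of_real \<sigma>) \<le> 2 powr \<sigma> * real n powr (-\<sigma>)"
        by (simp add: norm_divide norm_powr_real_powr')
    qed
  qed
  moreover have "summable (\<lambda>n. 2 powr \<sigma> * real n powr (-\<sigma>))"
    using \<sigma> by (intro summable_mult) (simp add: summable_real_powr_iff)
  ultimately show ?thesis
    unfolding hurwitz_zeta_def[abs_def] by (rule Weierstrass_m_test_ev)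
qed

lemma hurwitz_zeta_sums:
  assumes "\<sigma> > 1"
  shows "(\<lambda>k. 1 / (of_nat k + z) powr of_real \<sigma>) sums hurwitz_zeta \<sigma> z"
  using tendsto_uniform_limitI[OF hurwitz_zeta_uniform_limit[OF assms, of "{z}"]]
  by (simp add: sums_def)

lemma hurwitz_zeta_Suc:
  assumes "\<sigma> > 1"
  shows "hurwitz_zeta \<sigma> z = 1 / z powr of_real \<sigma> + hurwitz_zeta \<sigma> (z + 1)"
proof -
  have "(\<lambda>k. 1 / (of_nat (Suc k) + z) powr of_real \<sigma>) sums hurwitz_zeta \<sigma> (z + 1)"
    using hurwitz_zeta_sums[OF assms, of "z + 1"] by (simp add: algebra_simps)
  from sums_Suc[OF this] show ?thesis
    using hurwitz_zeta_sums[OF assms, of z] by (simp add: sums_iff add.commute)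
qed

lemma hurwitz_zeta_holomorphic:
  assumes "\<sigma> > 1"
  shows "hurwitz_zeta \<sigma> holomorphic_on - \<real>\<^sub>\<le>\<^sub>0"
proof (rule holomorphic_uniform_sequence)
  show "open (- \<real>\<^sub>\<le>\<^sub>0 :: complex set)"
    by (simp add: open_Compl)
  show "(\<lambda>z. \<Sum>k<N. 1 / (of_nat k + z) powr of_real \<sigma>) holomorphic_on - \<real>\<^sub>\<le>\<^sub>0" for N
    by (intro holomorphic_intros) (auto simp: complex_nonpos_Reals_iff add_eq_0_iff)
  fix z :: complex assume "z \<in> - \<real>\<^sub>\<le>\<^sub>0"
  then obtain d where "d > 0" "cball z d \<subseteq> - \<real>\<^sub>\<le>\<^sub>0"
    using open_contains_cball[of "- \<real>\<^sub>\<le>\<^sub>0 :: complex set"] by (auto simp: open_Compl)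
  then show "\<exists>d. 0 < d \<and> cball z d \<subseteq> - \<real>\<^sub>\<le>\<^sub>0 \<and>
      uniform_limit (cball z d) (\<lambda>N z. \<Sum>k<N. 1 / (of_nat k + z) powr of_real \<sigma>) (hurwitz_zeta \<sigma>) sequentially"
    using hurwitz_zeta_uniform_limit[OF assms bounded_cball] by blast
qed

text \<open>On the upper half-plane this is \<open>\<Sum>n\<in>\<int>. (q + n) powr -\<sigma>\<close>.\<close>

definition periodic_zeta :: "real \<Rightarrow> complex \<Rightarrow> complex" where
  "periodic_zeta \<sigma> q = hurwitz_zeta \<sigma> q + exp (- \<i> * of_real pi * of_real \<sigma>) * hurwitz_zeta \<sigma> (1 - q)"

text \<open>For \<open>q\<close> in the upper half-plane the principal logarithm of
  \<open>- q\<close> is that of \<open>q\<close> minus \<open>\<i> * pi\<close>, and the exponential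
  factor compensates this. Thereby the second Hurwitz series supplies the terms of negative index of
  a two-sided sum.\<close>

lemma powr_neg_upper_half_plane:
  assumes "Im q > 0"
  shows "exp (- \<i> * of_real pi * of_real \<sigma>) / (- q) powr of_real \<sigma> = 1 / q powr of_real \<sigma>"
proof -
  have "q \<noteq> 0" using assms by auto
  have "Ln (- q) = Ln q - \<i> * of_real pi"
    using assms \<open>q \<noteq> 0\<close> by (simp add: Ln_minus)
  then have "(- q) powr of_real \<sigma> = exp (of_real \<sigma> * (Ln q - \<i> * of_real pi))"
    using \<open>q \<noteq> 0\<close> by (simp add: powr_def)
  also have "\<dots> = q powr of_real \<sigma> * exp (- \<i> * of_real pi * of_real \<sigma>)"
    using \<open>q \<noteq> 0\<close> by (simp add: powr_def algebra_simps flip: exp_add)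
  finally have "(- q) powr of_real \<sigma> = q powr of_real \<sigma> * exp (- \<i> * of_real pi * of_real \<sigma>)" .
  then show ?thesis by simp
qed

text \<open>Singles out the term that is singular at \<open>q = 0\<close>; the bracket is continuous
  there.\<close>

lemma periodic_zeta_split:
  assumes "\<sigma> > 1"
  shows "periodic_zeta \<sigma> q = 1 / q powr of_real \<sigma>
    + (hurwitz_zeta \<sigma> (1 + q) + exp (- \<i> * of_real pi * of_real \<sigma>) * hurwitz_zeta \<sigma> (1 - q))"
  unfolding periodic_zeta_def using hurwitz_zeta_Suc[OF assms, of q] by (simp add: add.commute)

text \<open>Passing from \<open>q\<close> to \<open>q + 1\<close> drops the power of
  \<open>q\<close> from the first series and adds the power of \<open>- q\<close> to the second; the
  branch identity makes the two cancel.\<close>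

lemma periodic_zeta_plus1:
  assumes "\<sigma> > 1" "Im q > 0"
  shows "periodic_zeta \<sigma> (q + 1) = periodic_zeta \<sigma> q"
  using hurwitz_zeta_Suc[OF assms(1), of q] hurwitz_zeta_Suc[OF assms(1), of "- q"]
    powr_neg_upper_half_plane[OF assms(2), of \<sigma>]
  by (simp add: periodic_zeta_def algebra_simps)

lemma periodic_zeta_plus_nat:
  assumes "\<sigma> > 1" "Im q > 0"
  shows "periodic_zeta \<sigma> (q + of_nat n) = periodic_zeta \<sigma> q"
proof (induction n)
  case (Suc n)
  then show ?case
    using periodic_zeta_plus1[of \<sigma> "q + of_nat n"] assms by (simp add: algebra_simps)
qed simp

lemma periodic_zeta_plus_int:
  assumes "\<sigma> > 1" "Im q > 0"
  shows "periodic_zeta \<sigma> (q + of_int n) = periodic_zeta \<sigma> q"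
proof (cases "n \<ge> 0")
  case True
  then show ?thesis
    using periodic_zeta_plus_nat[OF assms, of "nat n"] by simp
next
  case False
  then show ?thesis
    using periodic_zeta_plus_nat[of \<sigma> "q + of_int n" "nat (- n)"] assms by simp
qed

lemma periodic_zeta_holomorphic:
  assumes "\<sigma> > 1"
  shows "periodic_zeta \<sigma> holomorphic_on {z. Im z > 0}"
proof -
  have "(hurwitz_zeta \<sigma> \<circ> (\<lambda>z. 1 - z)) holomorphic_on {z. Im z > 0}"
    by (rule holomorphic_on_compose_gen[OF _ hurwitz_zeta_holomorphic[OF assms]])
       (auto simp: complex_nonpos_Reals_iff intro!: holomorphic_intros)
  then have "(\<lambda>z. hurwitz_zeta \<sigma> (1 - z)) holomorphic_on {z. Im z > 0}"
    by (simp add: o_def)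
  moreover have "hurwitz_zeta \<sigma> holomorphic_on {z. Im z > 0}"
    by (rule holomorphic_on_subset[OF hurwitz_zeta_holomorphic[OF assms]]) (auto simp: complex_nonpos_Reals_iff)
  ultimately show ?thesis
    unfolding periodic_zeta_def[abs_def] by (intro holomorphic_intros)
qed

text \<open>As \<open>q\<close> tends to \<open>0\<close>, the term \<open>q powr -\<sigma>\<close> blows up while the others stay bounded.\<close>

lemma periodic_zeta_nontrivial:
  assumes "\<sigma> > 1"
  obtains q where "Im q > 0" "periodic_zeta \<sigma> q \<noteq> 0"
proof (rule ccontr)
  assume "\<not> thesis"
  with that have 0: "Im q > 0 \<Longrightarrow> periodic_zeta \<sigma> q = 0" for q
    by blast
  define y :: "nat \<Rightarrow> complex" where "y n = \<i> * of_real (1 / real (Suc n))" for n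
  define h where "h q = hurwitz_zeta \<sigma> (1 + q) + exp (- \<i> * of_real pi * of_real \<sigma>) * hurwitz_zeta \<sigma> (1 - q)" for q
  have "isCont (hurwitz_zeta \<sigma>) 1"
    using holomorphic_on_imp_continuous_on[OF hurwitz_zeta_holomorphic[OF assms]]
    by (rule continuous_on_interior) (simp add: interior_open open_Compl)
  then have "isCont (\<lambda>q. hurwitz_zeta \<sigma> (1 + q)) 0" "isCont (\<lambda>q. hurwitz_zeta \<sigma> (1 - q)) 0"
    using isCont_o2[of 0 "\<lambda>q. 1 + q" "hurwitz_zeta \<sigma>"] isCont_o2[of 0 "\<lambda>q. 1 - q" "hurwitz_zeta \<sigma>"]
    by simp_all
  then have "isCont h 0"
    unfolding h_def[abs_def] by (intro isCont_add isCont_mult continuous_const)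
  moreover have "y \<longlonglongrightarrow> 0"
    unfolding y_def
    by (rule tendsto_mult_right_zero) (use tendsto_of_real[OF LIMSEQ_inverse_real_of_nat, where 'a = complex] in
        \<open>simp add: inverse_eq_divide del: of_nat_Suc\<close>)
  ultimately have "(\<lambda>n. h (y n)) \<longlonglongrightarrow> h 0"
    by (rule isCont_tendsto_compose)
  from convergent_imp_Bseq[OF convergentI[OF this]] obtain B where B: "\<And>n. norm (h (y n)) \<le> B"
    by (metis BseqE)
  have "real (Suc n) \<le> B" for n
  proof -
    have "norm (h (y n)) = norm (1 / y n powr of_real \<sigma>)"
      using 0[of "y n"] periodic_zeta_split[OF assms, of "y n"]
      by (simp add: y_def h_def add_eq_0_iff norm_minus_cancel)
    also have "\<dots> = real (Suc n) powr \<sigma>"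
      by (simp add: norm_divide norm_powr_real_powr' y_def norm_mult powr_divide del: of_nat_Suc)
    also have "\<dots> \<ge> real (Suc n) powr 1"
      using assms by (intro powr_mono) auto
    finally show ?thesis using B[of n] by simp
  qed
  moreover obtain n where "B < real n"
    using reals_Archimedean2 by blast
  ultimately have "real (Suc n) < real n"
    by (meson le_less_trans)
  then show False by simp
qed

subsection \<open>Absence of zeros on the line of integration\<close>

definition spline_line :: "real \<Rightarrow> real \<Rightarrow> complex" where
  "spline_line a \<xi> = (of_real \<xi> + \<i> * of_real a) / of_real (2 * pi)"

lemma spline_line_Im [simp]: "Im (spline_line a \<xi>) = a / (2 * pi)"
  by (simp add: spline_line_def Im_divide_of_real del: of_real_mult)

lemma spline_line_diff: "spline_line a \<xi> - spline_line a \<eta> = of_real ((\<xi> - \<eta>) / (2 * pi))"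
  by (simp add: spline_line_def divide_simps algebra_simps)

lemma spline_integrand_alt:
  "spline_integrand a \<sigma> x \<xi> = spline_line a \<xi> powr (- of_real \<sigma>) / periodic_zeta \<sigma> (spline_line a \<xi>)
     * exp (\<i> * of_real \<xi> * of_real x)"
  by (simp add: spline_integrand_def Let_def periodic_zeta_def spline_line_def)

text \<open>A zero of the denominator has order at least one, and \<open>1 / \<bar>\<xi>\<bar>\<close> is not integrable at \<open>0\<close>.\<close>

lemma periodic_zeta_nonzero:
  assumes \<sigma>: "\<sigma> > 1" and a: "a > 0" and int: "integrable lborel (spline_integrand a \<sigma> 0)"
  shows "periodic_zeta \<sigma> (spline_line a \<xi>) \<noteq> 0"
proof
  define D where "D = periodic_zeta \<sigma>"
  define z where "z = spline_line a"
  assume "periodic_zeta \<sigma> (spline_line a \<xi>) = 0"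
  then have 0: "D (z \<xi>) = 0" by (simp add: D_def z_def)
  have hol: "D holomorphic_on {z. Im z > 0}"
    unfolding D_def by (rule periodic_zeta_holomorphic[OF \<sigma>])
  have op: "open {z. Im z > 0}" by (simp add: open_halfspace_Im_gt)
  have zIm: "z \<eta> \<in> {z. Im z > 0}" for \<eta> using a by (simp add: z_def)
  obtain \<beta> where "\<beta> \<in> {z. Im z > 0}" "D \<beta> \<noteq> 0"
    using periodic_zeta_nontrivial[OF \<sigma>] by (auto simp: D_def)
  \<comment> \<open>Further zeros near \<open>z \<xi>\<close> must be excluded: division by zero
    yields 0, so at such a point the integrand would be 0 and the lower bound below would
    fail.\<close>
  with isolated_zeros[OF hol op _ zIm 0] obtain r where r: "r > 0"
    "\<And>w. w \<in> ball (z \<xi>) r - {z \<xi>} \<Longrightarrow> D w \<noteq> 0"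
    by (metis convex_connected convex_halfspace_Im_gt)
  obtain D' where D': "(D has_field_derivative D') (at (z \<xi>))"
    using holomorphic_on_imp_differentiable_at[OF hol op zIm] by (auto simp: field_differentiable_def)
  define C where "C = norm D' + 1"
  have C: "C > 0" by (simp add: C_def add_nonneg_pos)
  have "((\<lambda>w. D w / (w - z \<xi>)) \<longlongrightarrow> D') (at (z \<xi>))"
    using D' 0 by (simp add: has_field_derivative_iff)
  then have "\<forall>\<^sub>F w in at (z \<xi>). norm (D w / (w - z \<xi>)) < C"
    by (intro order_tendstoD(2)[OF tendsto_norm]) (auto simp: C_def)
  then obtain s where s: "s > 0" "\<And>w. w \<noteq> z \<xi> \<Longrightarrow> dist w (z \<xi>) < s \<Longrightarrow> norm (D w / (w - z \<xi>)) < C"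
    unfolding eventually_at by blast
  define R where "R = norm (z \<xi>) + 1"
  define c where "c = R powr (-\<sigma>)"
  have c: "c > 0" by (simp add: c_def R_def add_nonneg_eq_0_iff)
  define h0 where "h0 = min 1 (min r s)"
  have h0: "h0 > 0" using r s by (simp add: h0_def)
  have lower: "c / (C * h) \<le> norm (spline_integrand a \<sigma> 0 \<eta>)"
    if "\<xi> < \<eta>" "\<eta> \<le> \<xi> + h" "0 < h" "h < h0" for \<eta> h
  proof -
    have dist: "norm (z \<eta> - z \<xi>) = (\<eta> - \<xi>) / (2 * pi)"
      using that unfolding z_def spline_line_diff by (simp only: norm_of_real) simp
    also have "\<dots> \<le> \<eta> - \<xi>"
      using that pi_gt3 by (simp add: divide_simps)
    finally have le: "norm (z \<eta> - z \<xi>) \<le> h" using that by simp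
    have ne: "z \<eta> \<noteq> z \<xi>" using dist that by auto
    have D0: "D (z \<eta>) \<noteq> 0"
      using r(2)[of "z \<eta>"] ne le that by (auto simp: h0_def dist_norm norm_minus_commute)
    have "norm (D (z \<eta>)) / norm (z \<eta> - z \<xi>) < C"
      using s(2)[OF ne] le that by (auto simp: h0_def dist_norm norm_divide)
    then have "norm (D (z \<eta>)) \<le> C * norm (z \<eta> - z \<xi>)"
      using ne by (simp add: divide_simps)
    also have "\<dots> \<le> C * h" using le C by simp
    finally have D_le: "norm (D (z \<eta>)) \<le> C * h" .
    have "norm (z \<eta>) \<le> R"
      using norm_triangle_ineq2[of "z \<eta>" "z \<xi>"] le that by (simp add: R_def h0_def)
    moreover have "norm (z \<eta>) > 0" using zIm[of \<eta>] by auto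
    ultimately have "c \<le> norm (z \<eta>) powr (-\<sigma>)"
      unfolding c_def using \<sigma> by (intro powr_mono2') auto
    then have "c / (C * h) \<le> norm (z \<eta>) powr (-\<sigma>) / norm (D (z \<eta>))"
      using D_le D0 c by (intro frac_le) auto
    also have "\<dots> = norm (spline_integrand a \<sigma> 0 \<eta>)"
      by (simp add: spline_integrand_alt norm_divide norm_mult D_def z_def norm_powr_real_powr')
    finally show ?thesis .
  qed
  \<comment> \<open>On an interval of length \<open>h\<close> the integrand is at least
    \<open>c / (C * h)\<close>, so for small \<open>h\<close> these integrals stay above
    \<open>c / C\<close>, while dominated convergence sends them to 0. The interval omits
    \<open>\<xi>\<close>, where the integrand has the default value 0.\<close>
  define u where "u n \<eta> = indicator {\<xi><..\<xi> + 1 / real (Suc n)} \<eta> *\<^sub>R norm (spline_integrand a \<sigma> 0 \<eta>)" for n \<eta>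
  have [measurable]: "spline_integrand a \<sigma> 0 \<in> borel_measurable lborel"
    using int by auto
  have u_int: "integrable lborel (u n)" for n
    unfolding u_def using int by (intro integrable_mult_indicator) auto
  have "(\<lambda>n. LINT \<eta>|lborel. u n \<eta>) \<longlonglongrightarrow> (LINT \<eta>|(lborel :: real measure). 0)"
  proof (rule integral_dominated_convergence)
    show "integrable lborel (\<lambda>\<eta>. norm (spline_integrand a \<sigma> 0 \<eta>))" using int by simp
    show "AE \<eta> in lborel. norm (u n \<eta>) \<le> norm (spline_integrand a \<sigma> 0 \<eta>)" for n
      by (auto simp: u_def indicator_def)
    show "AE \<eta> in lborel. (\<lambda>n. u n \<eta>) \<longlonglongrightarrow> 0"
    proof (intro AE_I2)
      fix \<eta>
      show "(\<lambda>n. u n \<eta>) \<longlonglongrightarrow> 0"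
      proof (cases "\<eta> > \<xi>")
        case True
        have "(\<lambda>n. \<xi> + 1 / real (Suc n)) \<longlonglongrightarrow> \<xi> + 0"
          by (intro tendsto_intros) (use LIMSEQ_inverse_real_of_nat in \<open>simp add: inverse_eq_divide\<close>)
        then have "\<forall>\<^sub>F n in sequentially. \<xi> + 1 / real (Suc n) < \<eta>"
          using True by (intro order_tendstoD(2)) auto
        then have "\<forall>\<^sub>F n in sequentially. u n \<eta> = 0"
          by eventually_elim (auto simp: u_def)
        then show ?thesis by (rule tendsto_eventually)
      qed (simp add: u_def)
    qed
    show "u n \<in> borel_measurable lborel" for n using u_int by auto
  qed simp
  then have lim: "(\<lambda>n. LINT \<eta>|lborel. u n \<eta>) \<longlonglongrightarrow> 0" by simp
  have "\<forall>\<^sub>F n in sequentially. inverse (real (Suc n)) < h0"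
    by (rule order_tendstoD(2)[OF LIMSEQ_inverse_real_of_nat h0])
  then have "\<forall>\<^sub>F n in sequentially. c / C \<le> (LINT \<eta>|lborel. u n \<eta>)"
  proof eventually_elim
    case (elim n)
    define h where "h = 1 / real (Suc n)"
    have h: "0 < h" "h < h0" using elim by (auto simp: h_def inverse_eq_divide)
    have "c / C = (LINT \<eta>|lborel. indicator {\<xi><..\<xi> + h} \<eta> *\<^sub>R (c / (C * h)))"
      using h by simp
    also have "\<dots> \<le> (LINT \<eta>|lborel. u n \<eta>)"
    proof (rule integral_mono[OF _ u_int])
      show "indicator {\<xi><..\<xi> + h} \<eta> *\<^sub>R (c / (C * h)) \<le> u n \<eta>" for \<eta>
        using lower[of \<eta> h] h by (auto simp: u_def h_def indicator_def)
    qed (use h in simp)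
    finally show ?case .
  qed
  then have "c / C \<le> 0"
    by (intro tendsto_lowerbound[OF lim]) auto
  with c C show False by (simp add: divide_le_0_iff)
qed

subsection \<open>Quadratic decay\<close>

text \<open>Passes from the Lebesgue integral over the line to gauge integrals over compact
  intervals, where the fundamental theorem of calculus and the decomposition into periods are
  available.\<close>

lemma integral_symmetric_tendsto:
  fixes f :: "real \<Rightarrow> complex"
  assumes f: "integrable lborel f" and c: "filterlim c at_top sequentially"
  shows "(\<lambda>n. integral {- c n..c n} f) \<longlonglongrightarrow> (LINT x|lborel. f x)"
proof -
  have "set_integrable lborel {- c n..c n} f" for n
    unfolding set_integrable_def using f by (intro integrable_mult_indicator) auto
  then have "integral {- c n..c n} f = (LINT x|lborel. indicator {- c n..c n} x *\<^sub>R f x)" for n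
    using set_borel_integral_eq_integral(2) unfolding set_lebesgue_integral_def by metis
  moreover have "(\<lambda>n. LINT x|lborel. indicator {- c n..c n} x *\<^sub>R f x) \<longlonglongrightarrow> (LINT x|lborel. f x)"
  proof (rule integral_dominated_convergence)
    show "integrable lborel (\<lambda>x. norm (f x))" using f by simp
    show "AE x in lborel. (\<lambda>n. indicator {- c n..c n} x *\<^sub>R f x) \<longlonglongrightarrow> f x"
    proof (intro AE_I2 tendsto_eventually)
      fix x
      have "\<forall>\<^sub>F n in sequentially. \<bar>x\<bar> \<le> c n"
        using c by (simp add: filterlim_at_top)
      then show "\<forall>\<^sub>F n in sequentially. indicator {- c n..c n} x *\<^sub>R f x = f x"
        by eventually_elim (auto simp: indicator_def)
    qed
    show "AE x in lborel. norm (indicator {- c n..c n} x *\<^sub>R f x) \<le> norm (f x)" for n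
      by (auto simp: indicator_def)
    show "(\<lambda>x. indicator {- c n..c n} x *\<^sub>R f x) \<in> borel_measurable lborel" for n
      using f by auto
  qed (use f in auto)
  ultimately show ?thesis by simp
qed

locale integrable_spline =
  fixes a \<sigma> :: real
  assumes \<sigma>: "\<sigma> > 1" and a: "a > 0" and int0: "integrable lborel (spline_integrand a \<sigma> 0)"
begin

abbreviation "D \<equiv> periodic_zeta \<sigma>"
abbreviation "z \<equiv> spline_line a"

text \<open>The integrand without its exponential, as a function of a complex variable so that
  Cauchy's inequality applies. Leaving out the exponential keeps all bounds independent of
  \<open>x\<close>.\<close>

definition g :: "complex \<Rightarrow> complex" where
  "g w = w powr (- of_real \<sigma>) / D w"

definition U :: "complex set" where
  "U = {w. Im w > 0} \<inter> D -` (- {0})"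

text \<open>The modulus of the power factor on the line. With the denominator bounded above and
  below near the line, \<open>W\<close> is an integrable weight that dominates \<open>g\<close> and
  all its derivatives up to constants.\<close>

definition W :: "real \<Rightarrow> real" where
  "W \<xi> = norm (z \<xi>) powr (-\<sigma>)"

lemma W_nonneg: "0 \<le> W \<xi>" by (simp add: W_def)

lemma continuous_D: "continuous_on {w. Im w > 0} D"
  using periodic_zeta_holomorphic[OF \<sigma>] by (rule holomorphic_on_imp_continuous_on)

lemma open_U: "open U"
  unfolding U_def by (rule continuous_open_preimage[OF continuous_D]) (auto simp: open_halfspace_Im_gt)

lemma z_in_U: "z \<xi> \<in> U"
  using periodic_zeta_nonzero[OF \<sigma> a int0] a by (simp add: U_def)

lemma holomorphic_g: "g holomorphic_on U"
proof -
  have "D holomorphic_on U"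
    by (rule holomorphic_on_subset[OF periodic_zeta_holomorphic[OF \<sigma>]]) (auto simp: U_def)
  then show ?thesis
    unfolding g_def[abs_def]
    by (intro holomorphic_intros) (auto simp: U_def complex_nonpos_Reals_iff)
qed

lemma spline_integrand_g: "spline_integrand a \<sigma> x \<xi> = g (z \<xi>) * exp (\<i> * of_real \<xi> * of_real x)"
  by (simp add: spline_integrand_alt g_def)

text \<open>One period of the line is a compact segment in the open set \<open>U\<close>, so a
  rectangle around it lies in \<open>U\<close> as well. The extrema of the modulus on this rectangle
  are bounds on the whole strip by periodicity.\<close>

lemma D_strip_bounds:
  obtains r m B where "r > 0" "r \<le> a / (4 * pi)" "m > 0"
    "\<And>w. \<bar>Im w - a / (2 * pi)\<bar> \<le> r \<Longrightarrow> m \<le> norm (D w) \<and> norm (D w) \<le> B"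
proof -
  define b where "b = a / (2 * pi)"
  have b: "b > 0" using a by (simp add: b_def)
  define A where "A = cbox (Complex 0 b) (Complex 1 b)"
  have "A \<subseteq> U"
  proof
    fix w assume "w \<in> A"
    then have "Im w = b" by (auto simp: A_def in_cbox_complex_iff)
    then have "w = z (2 * pi * Re w)"
      by (auto simp: complex_eq_iff spline_line_def b_def Re_divide_of_real Im_divide_of_real simp del: of_real_mult)
    then show "w \<in> U" using z_in_U by metis
  qed
  moreover have "compact A" by (simp add: A_def)
  ultimately obtain e where e: "e > 0" "(\<Union>x\<in>A. cball x e) \<subseteq> U"
    using compact_subset_open_imp_cball_epsilon_subset[OF _ open_U] by metis
  \<comment> \<open>The bound \<open>e\<close> keeps zeros out of the rectangle,
    \<open>b / 2\<close> keeps it above the real axis. The latter also prevents discs of radius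
    \<open>r\<close> from coming near 0 in \<open>deriv_g_bound\<close>.\<close>
  define r where "r = min e (b / 2)"
  have r: "r > 0" "r \<le> e" "r \<le> b / 2" using e b by (auto simp: r_def)
  define S where "S = cbox (Complex 0 (b - r)) (Complex 1 (b + r))"
  have "S \<subseteq> U"
  proof
    fix w assume w: "w \<in> S"
    have "Complex (Re w) b \<in> A" using w by (auto simp: S_def A_def in_cbox_complex_iff)
    moreover have "dist (Complex (Re w) b) w \<le> e"
      using w r by (auto simp: dist_norm complex_norm S_def in_cbox_complex_iff cmod_def)
    ultimately show "w \<in> U" using e(2) by (meson UN_I mem_cball subsetD)
  qed
  have cont: "continuous_on S (\<lambda>w. norm (D w))"
    by (intro continuous_on_norm continuous_on_subset[OF continuous_D]) (use \<open>S \<subseteq> U\<close> in \<open>auto simp: U_def\<close>)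
  have "compact S" "S \<noteq> {}"
    using r b by (auto simp: S_def box_ne_empty Basis_complex_def)
  then obtain w0 w1 where w0: "w0 \<in> S" "\<And>w. w \<in> S \<Longrightarrow> norm (D w0) \<le> norm (D w)"
    and w1: "w1 \<in> S" "\<And>w. w \<in> S \<Longrightarrow> norm (D w) \<le> norm (D w1)"
    using continuous_attains_inf[OF _ _ cont] continuous_attains_sup[OF _ _ cont] by blast
  have "norm (D w0) \<le> norm (D w) \<and> norm (D w) \<le> norm (D w1)" if "\<bar>Im w - b\<bar> \<le> r" for w
  proof -
    have "w - of_int \<lfloor>Re w\<rfloor> \<in> S"
      using that by (auto simp: S_def in_cbox_complex_iff abs_le_iff) linarith+
    moreover have "D (w - of_int \<lfloor>Re w\<rfloor>) = D w"
      using periodic_zeta_plus_int[OF \<sigma>, of w "- \<lfloor>Re w\<rfloor>"] that r b by (simp add: abs_le_iff)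
    ultimately show ?thesis using w0(2) w1(2) by metis
  qed
  moreover have "norm (D w0) > 0"
    using w0(1) \<open>S \<subseteq> U\<close> by (auto simp: U_def)
  ultimately show thesis
    using that[of r "norm (D w0)" "norm (D w1)"] r by (auto simp: b_def)
qed

text \<open>The upper bound on the denominator carries the integrability of the integrand over to
  its numerator.\<close>

lemma W_integrable: "integrable lborel W"
proof -
  obtain r m B where B: "r > 0" "\<And>w. \<bar>Im w - a / (2 * pi)\<bar> \<le> r \<Longrightarrow> m \<le> norm (D w) \<and> norm (D w) \<le> B"
    using D_strip_bounds by metis
  have [measurable]: "W \<in> borel_measurable borel"
    unfolding W_def spline_line_def by measurable
  show ?thesis
  proof (rule Bochner_Integration.integrable_bound)
    show "integrable lborel (\<lambda>\<xi>. B * norm (spline_integrand a \<sigma> 0 \<xi>))"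
      using int0 by simp
    have "W \<xi> \<le> B * norm (spline_integrand a \<sigma> 0 \<xi>)" for \<xi>
    proof -
      have "D (z \<xi>) \<noteq> 0" using z_in_U[of \<xi>] by (simp add: U_def)
      have "W \<xi> = norm (D (z \<xi>)) * norm (spline_integrand a \<sigma> 0 \<xi>)"
        using \<open>D (z \<xi>) \<noteq> 0\<close> by (simp add: spline_integrand_alt norm_mult norm_divide W_def norm_powr_real_powr')
      also have "\<dots> \<le> B * norm (spline_integrand a \<sigma> 0 \<xi>)"
        using B(2)[of "z \<xi>"] B(1) by (intro mult_right_mono) auto
      finally show ?thesis .
    qed
    then show "AE \<xi> in lborel. norm (W \<xi>) \<le> norm (B * norm (spline_integrand a \<sigma> 0 \<xi>))"
      using W_nonneg by (intro AE_I2) (auto intro: order_trans[OF _ abs_ge_self])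
  qed simp
qed

lemma W_tendsto:
  assumes "filterlim (\<lambda>n. \<bar>c n\<bar>) at_top F"
  shows "((\<lambda>n. W (c n)) \<longlongrightarrow> 0) F"
proof (rule tendsto_sandwich[where f = "\<lambda>_. 0" and h = "\<lambda>n. (\<bar>c n\<bar> / (2 * pi)) powr (-\<sigma>)"])
  have "W \<xi> \<le> (\<bar>\<xi>\<bar> / (2 * pi)) powr (-\<sigma>)" if "\<bar>\<xi>\<bar> \<ge> 1" for \<xi>
  proof -
    have "Re (z \<xi>) = \<xi> / (2 * pi)"
      by (simp add: spline_line_def Re_divide_of_real del: of_real_mult)
    then have "\<bar>\<xi>\<bar> / (2 * pi) \<le> norm (z \<xi>)"
      using abs_Re_le_cmod[of "z \<xi>"] by simp
    then show ?thesis
      unfolding W_def using that \<sigma> by (intro powr_mono2') auto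
  qed
  moreover have "\<forall>\<^sub>F n in F. \<bar>c n\<bar> \<ge> 1"
    using assms by (simp add: filterlim_at_top)
  ultimately show "\<forall>\<^sub>F n in F. W (c n) \<le> (\<bar>c n\<bar> / (2 * pi)) powr (-\<sigma>)"
    by (auto elim: eventually_mono)
  have "filterlim (\<lambda>n. \<bar>c n\<bar> / (2 * pi)) at_top F"
    using filterlim_tendsto_pos_mult_at_top[OF tendsto_const _ assms, of "1 / (2 * pi)"] by simp
  then show "((\<lambda>n. (\<bar>c n\<bar> / (2 * pi)) powr (-\<sigma>)) \<longlongrightarrow> 0) F"
    using \<sigma> by (intro tendsto_neg_powr) auto
qed (auto simp: W_nonneg)

text \<open>Cauchy's inequality on discs of one fixed radius: on the circle the power factor exceeds
  its value at the centre at most by the factor \<open>2 powr \<sigma>\<close>, and the denominator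
  is at least \<open>m\<close>, so the constant does not depend on \<open>\<xi>\<close>.\<close>

lemma deriv_g_bound:
  obtains C where "\<And>\<xi>. norm ((deriv ^^ n) g (z \<xi>)) \<le> C * W \<xi>"
proof -
  obtain r m B where r: "r > 0" "r \<le> a / (4 * pi)" and m: "m > 0"
    and B: "\<And>w. \<bar>Im w - a / (2 * pi)\<bar> \<le> r \<Longrightarrow> m \<le> norm (D w) \<and> norm (D w) \<le> B"
    using D_strip_bounds by metis
  have "norm ((deriv ^^ n) g (z \<xi>)) \<le> fact n * (2 powr \<sigma> / m * W \<xi>) / r ^ n" for \<xi>
  proof (rule Cauchy_inequality)
    have Im: "\<bar>Im w - a / (2 * pi)\<bar> \<le> r" if "dist (z \<xi>) w \<le> r" for w
      using abs_Im_le_cmod[of "z \<xi> - w"] that by (simp add: dist_norm abs_minus_commute)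
    have sub: "cball (z \<xi>) r \<subseteq> U"
    proof
      fix w assume "w \<in> cball (z \<xi>) r"
      then have w: "\<bar>Im w - a / (2 * pi)\<bar> \<le> r" using Im by simp
      moreover have "r < a / (2 * pi)" using r a by (simp add: field_simps)
      ultimately have "Im w > 0" by linarith
      moreover have "D w \<noteq> 0" using B[OF w] m by auto
      ultimately show "w \<in> U" by (simp add: U_def)
    qed
    show "g holomorphic_on ball (z \<xi>) r"
      using sub by (intro holomorphic_on_subset[OF holomorphic_g]) auto
    show "continuous_on (cball (z \<xi>) r) g"
      using sub by (intro holomorphic_on_imp_continuous_on holomorphic_on_subset[OF holomorphic_g])
    fix w assume w: "norm (z \<xi> - w) = r"
    then have m_le: "m \<le> norm (D w)" using B[OF Im[of w]] by (simp add: dist_norm)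
    have "a / (2 * pi) \<le> norm (z \<xi>)"
      using abs_Im_le_cmod[of "z \<xi>"] a by simp
    then have "r \<le> norm (z \<xi>) / 2" using r by simp
    then have "norm (z \<xi>) / 2 \<le> norm w"
      using norm_triangle_ineq2[of "z \<xi>" w] w by linarith
    moreover have "0 < norm (z \<xi>) / 2"
      using less_le_trans[OF divide_pos_pos[OF a] \<open>a / (2 * pi) \<le> norm (z \<xi>)\<close>] by simp
    ultimately have "norm w powr (-\<sigma>) \<le> (norm (z \<xi>) / 2) powr (-\<sigma>)"
      using \<sigma> by (intro powr_mono2') auto
    also have "\<dots> = 2 powr \<sigma> * W \<xi>"
      by (simp add: W_def powr_divide powr_minus divide_simps)
    finally have "norm w powr (-\<sigma>) / norm (D w) \<le> 2 powr \<sigma> * W \<xi> / m"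
      using m_le m by (intro frac_le) (auto simp: W_nonneg)
    then show "norm (g w) \<le> 2 powr \<sigma> / m * W \<xi>"
      by (simp add: g_def norm_divide norm_powr_real_powr')
  qed (rule r)
  then show thesis
    by (intro that[of "fact n * (2 powr \<sigma> / m) / r ^ n"]) (simp only: times_divide_eq_left mult.assoc)
qed

text \<open>The derivatives are taken in the complex variable, so each differentiation in
  \<open>\<xi>\<close> brings a factor \<open>1 / (2 * pi)\<close> from the slope of the
  line.\<close>

definition G :: "nat \<Rightarrow> real \<Rightarrow> complex" where
  "G n \<xi> = (deriv ^^ n) g (z \<xi>)"

lemma G_has_vector_derivative: "(G n has_vector_derivative G (Suc n) \<xi> / of_real (2 * pi)) (at \<xi> within T)"
proof -
  have "(z has_vector_derivative 1 / of_real (2 * pi)) (at \<xi>)"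
    unfolding spline_line_def[abs_def]
    by (auto intro!: derivative_eq_intros simp: has_vector_derivative_def scaleR_conv_of_real)
  moreover have "((deriv ^^ n) g has_field_derivative (deriv ^^ Suc n) g (z \<xi>)) (at (z \<xi>))"
    using holomorphic_derivI[OF holomorphic_higher_deriv[OF holomorphic_g open_U] open_U z_in_U] by simp
  ultimately have "((deriv ^^ n) g \<circ> z has_vector_derivative 1 / of_real (2 * pi) * (deriv ^^ Suc n) g (z \<xi>)) (at \<xi>)"
    by (rule field_vector_diff_chain_at)
  from has_vector_derivative_at_within[OF this, of T] show ?thesis
    by (simp add: o_def G_def[abs_def])
qed

lemma G_continuous: "continuous_on T (G n)"
  using G_has_vector_derivative by (rule continuous_on_vector_derivative)

lemma G_measurable [measurable]: "G n \<in> borel_measurable borel"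
  by (rule borel_measurable_continuous_onI[OF G_continuous])

lemma G_integrable: "integrable lborel (G n)"
proof -
  obtain C where C: "\<And>\<xi>. norm (G n \<xi>) \<le> C * W \<xi>"
    unfolding G_def using deriv_g_bound by metis
  show ?thesis
  proof (rule Bochner_Integration.integrable_bound)
    show "integrable lborel (\<lambda>\<xi>. C * W \<xi>)" using W_integrable by simp
    show "AE \<xi> in lborel. norm (G n \<xi>) \<le> norm (C * W \<xi>)"
      using C by (intro AE_I2) (auto intro: order_trans[OF _ abs_ge_self])
  qed simp
qed

lemma G_tendsto:
  assumes "filterlim (\<lambda>n. \<bar>c n\<bar>) at_top F"
  shows "((\<lambda>n. G k (c n)) \<longlongrightarrow> 0) F"
proof -
  obtain C where C: "\<And>\<xi>. norm (G k \<xi>) \<le> C * W \<xi>"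
    unfolding G_def using deriv_g_bound by metis
  show ?thesis
    by (rule Lim_null_comparison[OF _ tendsto_mult_right_zero[OF W_tendsto[OF assms], of C]])
       (auto intro: C always_eventually)
qed

lemma spline_G: "fundamental_spline a \<sigma> x =
    1 / of_real (2 * pi) * (LINT \<xi>|lborel. G 0 \<xi> * exp (\<i> * of_real \<xi> * of_real x))"
  by (simp add: fundamental_spline_def spline_integrand_g G_def)

lemma G_exp_integrable: "integrable lborel (\<lambda>\<xi>. G n \<xi> * exp (\<i> * of_real \<xi> * of_real x))"
proof (rule Bochner_Integration.integrable_bound[OF G_integrable[of n]])
  show "AE \<xi> in lborel. norm (G n \<xi> * exp (\<i> * of_real \<xi> * of_real x)) \<le> norm (G n \<xi>)"
    by (auto simp: norm_mult)
qed measurable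

text \<open>Two integrations by parts: \<open>F\<close> below is a primitive of the combined integrand.\<close>

lemma integral_G_2:
  "(LINT \<xi>|lborel. G 2 \<xi> * exp (\<i> * of_real \<xi> * of_real x))
    = - of_real ((2 * pi * x)\<^sup>2) * (LINT \<xi>|lborel. G 0 \<xi> * exp (\<i> * of_real \<xi> * of_real x))"
proof -
  define p :: complex where "p = of_real (2 * pi)"
  have p: "p \<noteq> 0" by (simp add: p_def)
  define e where "e \<xi> = exp (\<i> * of_real \<xi> * of_real x)" for \<xi> :: real
  define F where "F \<xi> = (G 1 \<xi> / p - \<i> * of_real x * G 0 \<xi>) * e \<xi>" for \<xi>
  \<comment> \<open>In the derivative of \<open>F\<close> the two terms with \<open>G 1\<close>
    cancel; \<open>f\<close> is what remains.\<close>
  define f where "f \<xi> = (1 / p\<^sup>2) * (G 2 \<xi> * e \<xi>) + of_real (x\<^sup>2) * (G 0 \<xi> * e \<xi>)" for \<xi>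
  have e': "(e has_vector_derivative \<i> * of_real x * e \<xi>) (at \<xi> within T)" for \<xi> T
    unfolding e_def[abs_def]
    by (rule has_vector_derivative_real_field[where f = "\<lambda>u. exp (\<i> * u * of_real x)"])
       (auto intro!: derivative_eq_intros)
  have F': "(F has_vector_derivative f \<xi>) (at \<xi> within T)" for \<xi> T
  proof -
    have 1: "(G (Suc 0) has_vector_derivative G 2 \<xi> / p) (at \<xi> within T)"
      using G_has_vector_derivative[of 1 \<xi> T] by (simp add: p_def numeral_2_eq_2)
    have 0: "(G 0 has_vector_derivative G (Suc 0) \<xi> / p) (at \<xi> within T)"
      using G_has_vector_derivative[of 0 \<xi> T] by (simp add: p_def)
    have "(F has_vector_derivative
        (G 2 \<xi> / p / p - \<i> * of_real x * (G (Suc 0) \<xi> / p)) * e \<xi>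
        + (G 1 \<xi> / p - \<i> * of_real x * G 0 \<xi>) * (\<i> * of_real x * e \<xi>)) (at \<xi> within T)"
      unfolding F_def[abs_def]
      by (rule derivative_eq_intros e' 0 1 refl | simp add: divide_inverse)+
    also have "(G 2 \<xi> / p / p - \<i> * of_real x * (G (Suc 0) \<xi> / p)) * e \<xi>
        + (G 1 \<xi> / p - \<i> * of_real x * G 0 \<xi>) * (\<i> * of_real x * e \<xi>) = f \<xi>"
      unfolding f_def using p by (simp add: field_simps power2_eq_square)
    finally show ?thesis .
  qed
  have f_int: "integrable lborel f"
    unfolding f_def e_def using G_exp_integrable by auto
  have "(f has_integral F (real n) - F (- real n)) {- real n..real n}" for n
    by (rule fundamental_theorem_of_calculus) (auto intro: F')
  then have "integral {- real n..real n} f = F (real n) - F (- real n)" for n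
    by (rule integral_unique)
  \<comment> \<open>Used for \<open>c n = n\<close> and \<open>c n = - n\<close>: the boundary terms
    vanish at both ends, so \<open>f\<close> has integral 0.\<close>
  moreover have lim: "((\<lambda>n. F (c n)) \<longlongrightarrow> 0) sequentially"
    if c: "filterlim (\<lambda>n. \<bar>c n\<bar>) at_top sequentially" for c
  proof (rule Lim_null_comparison)
    show "\<forall>\<^sub>F n in sequentially. norm (F (c n)) \<le> norm (G 1 (c n) / p - \<i> * of_real x * G 0 (c n))"
      by (auto simp: F_def e_def norm_mult)
    have "(\<lambda>n. G 1 (c n) / p - \<i> * of_real x * G 0 (c n)) \<longlonglongrightarrow> 0 / p - \<i> * of_real x * 0"
      by (intro tendsto_intros G_tendsto c p)
    then show "(\<lambda>n. norm (G 1 (c n) / p - \<i> * of_real x * G 0 (c n))) \<longlonglongrightarrow> 0"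
      using tendsto_norm_zero by fastforce
  qed
  ultimately have "(\<lambda>n. integral {- real n..real n} f) \<longlonglongrightarrow> 0 - 0"
    by (simp only:) (intro tendsto_diff lim; simp add: filterlim_real_sequentially)
  with integral_symmetric_tendsto[OF f_int filterlim_real_sequentially]
  have "(LINT \<xi>|lborel. f \<xi>) = 0"
    using LIMSEQ_unique by fastforce
  then have "(1 / p\<^sup>2) * (LINT \<xi>|lborel. G 2 \<xi> * e \<xi>) + of_real (x\<^sup>2) * (LINT \<xi>|lborel. G 0 \<xi> * e \<xi>) = 0"
    unfolding f_def using G_exp_integrable[of 2 x] G_exp_integrable[of 0 x] by (simp add: e_def)
  then have "(LINT \<xi>|lborel. G 2 \<xi> * e \<xi>) = - (p\<^sup>2 * of_real (x\<^sup>2)) * (LINT \<xi>|lborel. G 0 \<xi> * e \<xi>)"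
    using p by (simp add: divide_simps add_eq_0_iff mult_ac)
  then show ?thesis
    by (simp add: e_def p_def power_mult_distrib)
qed

text \<open>The trivial bound serves small \<open>x\<close>, the one after two integrations by parts
  serves large \<open>x\<close>; adding them avoids a case distinction.\<close>

lemma spline_decay:
  obtains C where "C \<ge> 0" "\<And>x. norm (fundamental_spline a \<sigma> x) \<le> C / (1 + x\<^sup>2)"
proof -
  define C where "C n = (LINT \<xi>|lborel. norm (G n \<xi>))" for n
  have C0: "C n \<ge> 0" for n by (simp add: C_def)
  have bound: "norm (LINT \<xi>|lborel. G n \<xi> * exp (\<i> * of_real \<xi> * of_real x)) \<le> C n" for n x
    using integral_norm_bound[of lborel "\<lambda>\<xi>. G n \<xi> * exp (\<i> * of_real \<xi> * of_real x)"]
    by (simp add: norm_mult C_def)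
  have "norm (fundamental_spline a \<sigma> x) \<le> (C 0 + C 2) / (1 + x\<^sup>2)" for x
  proof -
    define J where "J = norm (LINT \<xi>|lborel. G 0 \<xi> * exp (\<i> * of_real \<xi> * of_real x))"
    have "(2 * pi * x)\<^sup>2 * J \<le> C 2"
      using bound[of 2 x] unfolding integral_G_2 J_def by (simp add: norm_mult norm_power power_mult_distrib)
    moreover have "x\<^sup>2 \<le> (2 * pi * x)\<^sup>2"
    proof -
      have "1 \<le> (2 * pi)\<^sup>2" using pi_gt3 by (intro one_le_power) simp
      from mult_right_mono[OF this, of "x\<^sup>2"] show ?thesis by (simp add: power_mult_distrib)
    qed
    then have "x\<^sup>2 * J \<le> (2 * pi * x)\<^sup>2 * J" by (intro mult_right_mono) (simp_all add: J_def)
    moreover have "J \<le> C 0" using bound[of 0 x] by (simp add: J_def)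
    ultimately have "(1 + x\<^sup>2) * J \<le> C 0 + C 2" by (simp add: algebra_simps)
    moreover have "norm (fundamental_spline a \<sigma> x) \<le> J"
    proof -
      have "norm (fundamental_spline a \<sigma> x) = J / (2 * pi)"
        by (simp add: spline_G J_def norm_mult norm_divide)
      also have "\<dots> \<le> J"
        using pi_gt3 by (simp add: divide_simps J_def mult_le_cancel_left1)
      finally show ?thesis .
    qed
    ultimately have "(1 + x\<^sup>2) * norm (fundamental_spline a \<sigma> x) \<le> C 0 + C 2"
      by (smt (verit) mult_left_mono zero_le_power2)
    then show ?thesis
      by (subst pos_le_divide_eq) (simp_all add: add_pos_nonneg mult.commute)
  qed
  with that[of "C 0 + C 2"] C0 show thesis by (simp add: add_nonneg_nonneg)
qed

end

lemma summable_on_int_inverse_square: "(\<lambda>k::int. 1 / (1 + (real_of_int k)\<^sup>2)) summable_on UNIV"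
proof -
  have nat: "(\<lambda>n::nat. 1 / (1 + (real n)\<^sup>2)) summable_on UNIV"
  proof (rule norm_summable_imp_summable_on, rule summable_comparison_test_ev)
    show "summable (\<lambda>n. 1 / (real n)\<^sup>2)"
      using inverse_power_summable[of 2, where 'a = real] by (simp add: inverse_eq_divide)
    show "\<forall>\<^sub>F n in sequentially. norm (norm (1 / (1 + (real n)\<^sup>2))) \<le> 1 / (real n)\<^sup>2"
      using eventually_gt_at_top[of 0]
      by eventually_elim (auto simp: add_nonneg_nonneg intro!: divide_left_mono mult_pos_pos add_pos_pos)
  qed
  have "(\<lambda>k. 1 / (1 + (real_of_int k)\<^sup>2)) summable_on range int"
    using nat by (subst summable_on_reindex) (auto simp: o_def inj_def)
  moreover have "(\<lambda>k. 1 / (1 + (real_of_int k)\<^sup>2)) summable_on range (\<lambda>n. - int n)"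
    using nat by (subst summable_on_reindex) (auto simp: o_def inj_def)
  moreover have "k \<in> range int \<union> range (\<lambda>n. - int n)" for k
    by (cases k rule: int_cases2) auto
  then have "range int \<union> range (\<lambda>n. - int n) = UNIV"
    by auto
  ultimately show ?thesis
    using summable_on_union by metis
qed

context integrable_spline
begin

text \<open>Shifting the index by the floor of \<open>t\<close> puts the offset into the unit
  interval. Then \<open>\<bar>k\<bar> \<le> \<bar>s\<bar> + 1\<close>, hence
  \<open>1 + k^2 \<le> 3 * (1 + s^2)\<close>, and the majorant \<open>u\<close> no longer involves
  \<open>t\<close>.\<close>

lemma spline_translates_bounded:
  obtains M where "\<And>t. (\<lambda>k. norm (fundamental_spline a \<sigma> (t - of_int k))) summable_on UNIV"
    "\<And>t. (\<Sum>\<^sub>\<infinity>k. norm (fundamental_spline a \<sigma> (t - of_int k))) \<le> M"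
proof -
  obtain C where C: "C \<ge> 0" "\<And>x. norm (fundamental_spline a \<sigma> x) \<le> C / (1 + x\<^sup>2)"
    using spline_decay by blast
  define u where "u k = 3 * C * (1 / (1 + (real_of_int k)\<^sup>2))" for k :: int
  have u: "u summable_on UNIV"
    unfolding u_def by (intro summable_on_cmult_right summable_on_int_inverse_square)
  have le: "norm (fundamental_spline a \<sigma> (t - of_int (k + \<lfloor>t\<rfloor>))) \<le> u k" for t k
  proof -
    define s where "s = t - of_int (k + \<lfloor>t\<rfloor>)"
    have "\<bar>real_of_int k\<bar> \<le> \<bar>s\<bar> + 1"
      unfolding s_def by simp linarith
    then have "(real_of_int k)\<^sup>2 \<le> (\<bar>s\<bar> + 1)\<^sup>2"
      by (metis abs_ge_zero abs_le_square_iff abs_of_nonneg add_nonneg_nonneg power2_abs power_mono zero_le_one)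
    also have "\<dots> \<le> 2 * s\<^sup>2 + 2"
      using sum_squares_bound[of "\<bar>s\<bar>" 1] by (simp add: power2_sum)
    finally have "1 + (real_of_int k)\<^sup>2 \<le> 3 * (1 + s\<^sup>2)"
      by (smt (verit) zero_le_power2)
    then have "1 / (1 + s\<^sup>2) \<le> 3 * (1 / (1 + (real_of_int k)\<^sup>2))"
      by (simp add: add_pos_nonneg divide_simps)
    from mult_left_mono[OF this C(1)] show ?thesis
      using C(2)[of s] by (simp add: u_def s_def mult_ac)
  qed
  have bij: "bij_betw (\<lambda>k. k + \<lfloor>t\<rfloor>) UNIV UNIV" for t :: real
    by (rule bij_betw_byWitness[where f' = "\<lambda>k. k - \<lfloor>t\<rfloor>"]) auto
  have sum: "(\<lambda>k. norm (fundamental_spline a \<sigma> (t - of_int (k + \<lfloor>t\<rfloor>)))) summable_on UNIV" for t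
    by (rule summable_on_comparison_test[OF u]) (use le in auto)
  show thesis
  proof (rule that)
    show "(\<lambda>k. norm (fundamental_spline a \<sigma> (t - of_int k))) summable_on UNIV" for t
      using sum[of t] summable_on_reindex_bij_betw[OF bij[of t], of "\<lambda>k. norm (fundamental_spline a \<sigma> (t - of_int k))"]
      by simp
    have "(\<Sum>\<^sub>\<infinity>k. norm (fundamental_spline a \<sigma> (t - of_int k)))
        = (\<Sum>\<^sub>\<infinity>k. norm (fundamental_spline a \<sigma> (t - of_int (k + \<lfloor>t\<rfloor>))))" for t
      using infsum_reindex_bij_betw[OF bij[of t], of "\<lambda>k. norm (fundamental_spline a \<sigma> (t - of_int k))"] by simp
    also have "\<dots> t \<le> infsum u UNIV" for t
      by (rule infsum_mono[OF sum u le])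
    finally show "(\<Sum>\<^sub>\<infinity>k. norm (fundamental_spline a \<sigma> (t - of_int k))) \<le> infsum u UNIV" for t .
  qed
qed

end

subsection \<open>Interpolation\<close>

lemma integral_exp_period:
  "integral {0..2 * pi} (\<lambda>\<xi>. exp (\<i> * of_real \<xi> * of_int j)) = (if j = 0 then of_real (2 * pi) else 0)"
proof (cases "j = 0")
  case False
  define F where "F u = exp (\<i> * u * of_int j) / (\<i> * of_int j)" for u :: complex
  have "((\<lambda>\<xi>. F (of_real \<xi>)) has_vector_derivative exp (\<i> * of_real \<xi> * of_int j)) (at \<xi> within {0..2 * pi})" for \<xi>
    unfolding F_def
    by (rule has_vector_derivative_real_field[where f = "\<lambda>u. exp (\<i> * u * of_int j) / (\<i> * of_int j)"])
       (use False in \<open>auto intro!: derivative_eq_intros\<close>)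
  then have "((\<lambda>\<xi>. exp (\<i> * of_real \<xi> * of_int j)) has_integral F (of_real (2 * pi)) - F (of_real 0)) {0..2 * pi}"
    by (intro fundamental_theorem_of_calculus) auto
  moreover have "exp (\<i> * of_real (2 * pi) * of_int j) = 1"
    by (subst exp_eq_1) (auto intro!: exI[of _ j])
  ultimately show ?thesis
    using False by (simp add: F_def integral_unique)
qed (simp add: scaleR_conv_of_real)

lemma integral_shift_period:
  fixes f :: "real \<Rightarrow> complex"
  assumes "continuous_on UNIV f"
  shows "integral {c..c + p} f = integral {0..p} (\<lambda>x. f (x + c))"
proof -
  have "f integrable_on cbox c (c + p)"
    by (intro integrable_continuous continuous_on_subset[OF assms]) auto
  from has_integral_affinity'[OF integrable_integral[OF this], of 1 c] show ?thesis
    by (simp add: integral_unique)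
qed

text \<open>The \<open>2 * N\<close> periods are paired as \<open>n\<close> with
  \<open>- (n + 1)\<close>, which matches the \<open>n\<close>-th terms of the Hurwitz series at
  \<open>q\<close> and at \<open>1 - q\<close>.\<close>

lemma integral_symmetric_periods:
  fixes f :: "real \<Rightarrow> complex"
  assumes f: "continuous_on UNIV f" and p: "p > 0"
  shows "integral {- (real N * p)..real N * p} f
    = integral {0..p} (\<lambda>x. \<Sum>n<N. f (x + real n * p) + f (x - real (Suc n) * p))"
proof (induction N)
  case (Suc N)
  have i: "f integrable_on {u..v}" for u v
    by (intro integrable_continuous_real continuous_on_subset[OF f]) auto
  have c: "continuous_on T (\<lambda>x. f (x + c))" for T c
    by (rule continuous_on_compose2[OF f]) (auto intro!: continuous_intros)
  have i2: "(\<lambda>x. f (x + c)) integrable_on {0..p}" for c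
    by (intro integrable_continuous_real c)
  let ?a = "real N * p" and ?b = "real (Suc N) * p"
  have b: "?b = ?a + p" by (simp add: algebra_simps)
  have a0: "0 \<le> ?a" using p by simp
  have "integral {- ?b..?b} f = integral {- ?b..- ?a} f + (integral {- ?a..?a} f + integral {?a..?b} f)"
    using Henstock_Kurzweil_Integration.integral_combine[of "- ?b" "- ?a" ?b f]
      Henstock_Kurzweil_Integration.integral_combine[of "- ?a" ?a ?b f] i b a0 p by simp
  also have "integral {?a..?b} f = integral {0..p} (\<lambda>x. f (x + ?a))"
    unfolding b by (rule integral_shift_period[OF f])
  also have "integral {- ?b..- ?a} f = integral {0..p} (\<lambda>x. f (x - ?b))"
    using integral_shift_period[OF f, of "- ?b" p] b by simp
  also note Suc.IH
  also have "integral {0..p} (\<lambda>x. f (x - ?b)) + (integral {0..p} (\<lambda>x. \<Sum>n<N. f (x + real n * p) + f (x - real (Suc n) * p))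
      + integral {0..p} (\<lambda>x. f (x + ?a)))
    = integral {0..p} (\<lambda>x. (\<Sum>n<N. f (x + real n * p) + f (x - real (Suc n) * p)) + (f (x + ?a) + f (x - ?b)))"
  proof -
    have 1: "(\<lambda>x. f (x + ?a)) integrable_on {0..p}" "(\<lambda>x. f (x - ?b)) integrable_on {0..p}"
      using i2[of ?a] i2[of "- ?b"] by simp_all
    have "(\<lambda>x. \<Sum>n<N. f (x + real n * p) + f (x - real (Suc n) * p)) integrable_on {0..p}"
      using i2 i2[of "- (real (Suc _) * p)"]
      by (intro integrable_sum integrable_add) (auto simp del: of_nat_Suc)
    then show ?thesis
      using 1 by (simp add: Henstock_Kurzweil_Integration.integral_add integrable_add del: of_nat_Suc)
  qed
  finally show ?case by simp
qed simp

context integrable_spline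
begin

text \<open>Exponential and denominator are periodic, so folding the line onto one period affects
  only the power. The folded sum is \<open>e\<close> times the ratio of a partial sum of the
  denominator to the denominator itself. It tends to \<open>e\<close> uniformly, and integrating
  \<open>e\<close> over a period gives the Kronecker delta.\<close>

lemma spline_interpolates:
  "fundamental_spline a \<sigma> (of_int j) = (if j = 0 then 1 else 0)"
proof -
  define e where "e \<xi> = exp (\<i> * of_real \<xi> * of_int j)" for \<xi> :: real
  define E where "E \<xi> = G 0 \<xi> * e \<xi>" for \<xi>
  define \<epsilon> where "\<epsilon> = exp (- \<i> * of_real pi * of_real \<sigma>)"
  define t where "t n w = 1 / (of_nat n + w) powr of_real \<sigma>" for n and w :: complex
  have e_cont: "continuous_on T e" for T
    unfolding e_def[abs_def] by (intro continuous_intros)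
  have E_cont: "continuous_on T E" for T
    unfolding E_def[abs_def] by (intro continuous_intros G_continuous e_cont)
  have E_int: "integrable lborel E"
    using G_exp_integrable[of 0 "of_int j"] by (simp add: E_def[abs_def] e_def)
  have e_shift: "e (\<xi> + of_int k * (2 * pi)) = e \<xi>" for \<xi> k
  proof -
    have "exp (\<i> * of_real (of_int k * (2 * pi)) * of_int j) = 1"
      by (subst exp_eq_1) (auto intro!: exI[of _ "k * j"])
    then show ?thesis
      by (simp add: e_def algebra_simps exp_add)
  qed
  have z_shift: "z (\<xi> + of_int k * (2 * pi)) = z \<xi> + of_int k" for \<xi> k
    by (simp add: spline_line_def field_simps)
  have E_shift: "E (\<xi> + of_int k * (2 * pi)) = e \<xi> / D (z \<xi>) * (1 / (z \<xi> + of_int k) powr of_real \<sigma>)" for \<xi> k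
    unfolding E_def e_shift G_def g_def z_shift using periodic_zeta_plus_int[OF \<sigma>, of "z \<xi>" k] a
    by (simp add: powr_minus divide_simps)
  have pair: "E (\<xi> + real n * (2 * pi)) + E (\<xi> - real (Suc n) * (2 * pi))
      = e \<xi> / D (z \<xi>) * (t n (z \<xi>) + \<epsilon> * t n (1 - z \<xi>))" for \<xi> n
  proof -
    have "E (\<xi> + real n * (2 * pi)) = e \<xi> / D (z \<xi>) * t n (z \<xi>)"
      using E_shift[of \<xi> "int n"] by (simp add: t_def add.commute)
    moreover have "E (\<xi> - real (Suc n) * (2 * pi)) = e \<xi> / D (z \<xi>) * (1 / (z \<xi> - of_nat (Suc n)) powr of_real \<sigma>)"
      using E_shift[of \<xi> "- int (Suc n)"] by (simp del: of_nat_Suc)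
    moreover have "1 / (z \<xi> - of_nat (Suc n)) powr of_real \<sigma> = \<epsilon> * t n (1 - z \<xi>)"
      using powr_neg_upper_half_plane[of "z \<xi> - of_nat (Suc n)" \<sigma>] a
      by (simp add: \<epsilon>_def t_def algebra_simps)
    ultimately show ?thesis by (simp only: distrib_left)
  qed
  define S where "S N \<xi> = (\<Sum>n<N. E (\<xi> + real n * (2 * pi)) + E (\<xi> - real (Suc n) * (2 * pi)))" for N \<xi>
  have S_eq: "S N \<xi> = e \<xi> / D (z \<xi>) * ((\<Sum>n<N. t n (z \<xi>)) + \<epsilon> * (\<Sum>n<N. t n (1 - z \<xi>)))" for N \<xi>
    unfolding S_def pair by (simp add: sum_distrib_left sum.distrib distrib_left)
  have z_bounded: "bounded (z ` {0..2 * pi})"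
    unfolding spline_line_def[abs_def]
    by (intro compact_imp_bounded compact_continuous_image continuous_intros) auto
  have "uniform_limit {0..2 * pi} S
      (\<lambda>\<xi>. e \<xi> / D (z \<xi>) * (hurwitz_zeta \<sigma> (z \<xi>) + \<epsilon> * hurwitz_zeta \<sigma> (1 - z \<xi>))) sequentially"
  proof -
    have 1: "uniform_limit {0..2 * pi} (\<lambda>N \<xi>. \<Sum>n<N. t n (z \<xi>)) (\<lambda>\<xi>. hurwitz_zeta \<sigma> (z \<xi>)) sequentially"
      unfolding t_def by (rule uniform_limit_compose'[OF hurwitz_zeta_uniform_limit[OF \<sigma> z_bounded]]) auto
    have 2: "uniform_limit {0..2 * pi} (\<lambda>N \<xi>. \<Sum>n<N. t n (1 - z \<xi>)) (\<lambda>\<xi>. hurwitz_zeta \<sigma> (1 - z \<xi>)) sequentially"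
    proof -
      have "bounded ((\<lambda>\<xi>. 1 - z \<xi>) ` {0..2 * pi})"
        unfolding spline_line_def[abs_def]
        by (intro compact_imp_bounded compact_continuous_image continuous_intros) auto
      then show ?thesis
        unfolding t_def by (rule uniform_limit_compose'[OF hurwitz_zeta_uniform_limit[OF \<sigma>]]) auto
    qed
    have D_cont: "continuous_on {0..2 * pi} (\<lambda>\<xi>. D (z \<xi>))"
      by (rule continuous_on_compose2[OF continuous_D])
         (use a in \<open>auto simp: spline_line_def[abs_def] intro!: continuous_intros\<close>)
    then have "continuous_on {0..2 * pi} (\<lambda>\<xi>. e \<xi> / D (z \<xi>))"
      by (intro continuous_on_divide e_cont) (use z_in_U in \<open>auto simp: U_def\<close>)
    then have bounded_e: "bounded ((\<lambda>\<xi>. e \<xi> / D (z \<xi>)) ` {0..2 * pi})"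
      by (intro compact_imp_bounded compact_continuous_image) auto
    have sum_lim: "uniform_limit {0..2 * pi} (\<lambda>N \<xi>. (\<Sum>n<N. t n (z \<xi>)) + \<epsilon> * (\<Sum>n<N. t n (1 - z \<xi>)))
      (\<lambda>\<xi>. hurwitz_zeta \<sigma> (z \<xi>) + \<epsilon> * hurwitz_zeta \<sigma> (1 - z \<xi>)) sequentially"
      by (intro uniform_limit_add 1 bounded_linear.uniform_limit[OF bounded_linear_mult_right] 2)
    have "bounded ((\<lambda>\<xi>. hurwitz_zeta \<sigma> (z \<xi>) + \<epsilon> * hurwitz_zeta \<sigma> (1 - z \<xi>)) ` {0..2 * pi})"
      using D_cont compact_imp_bounded[OF compact_continuous_image[OF D_cont]]
      by (simp add: periodic_zeta_def \<epsilon>_def)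
    from uniform_lim_mult[OF uniform_limit_const sum_lim bounded_e this] show ?thesis
      unfolding S_eq[abs_def] .
  qed
  also have "(\<lambda>\<xi>. e \<xi> / D (z \<xi>) * (hurwitz_zeta \<sigma> (z \<xi>) + \<epsilon> * hurwitz_zeta \<sigma> (1 - z \<xi>))) = e"
  proof
    fix \<xi>
    have "hurwitz_zeta \<sigma> (z \<xi>) + \<epsilon> * hurwitz_zeta \<sigma> (1 - z \<xi>) = D (z \<xi>)"
      by (simp add: periodic_zeta_def \<epsilon>_def)
    then show "e \<xi> / D (z \<xi>) * (hurwitz_zeta \<sigma> (z \<xi>) + \<epsilon> * hurwitz_zeta \<sigma> (1 - z \<xi>)) = e \<xi>"
      using z_in_U[of \<xi>] by (simp add: U_def)
  qed
  finally have lim: "uniform_limit {0..2 * pi} S e sequentially" .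
  have S_cont: "continuous_on {0..2 * pi} (S N)" for N
    unfolding S_def[abs_def]
    by (intro continuous_intros continuous_on_compose2[OF E_cont[of UNIV]]) auto
  obtain I J where I: "\<And>N. (S N has_integral I N) {0..2 * pi}" and J: "(e has_integral J) {0..2 * pi}"
    and IJ: "I \<longlonglongrightarrow> J"
    using uniform_limit_integral[OF lim S_cont] by auto
  \<comment> \<open>The integrals of the folded sums are also those of \<open>E\<close> over growing
    symmetric intervals, so the limit \<open>J\<close> equals the integral over the line.\<close>
  have "I N = integral {- (real N * (2 * pi))..real N * (2 * pi)} E" for N
    using integral_symmetric_periods[OF E_cont, of "2 * pi" N] integral_unique[OF I[of N]] by (simp add: S_def[abs_def])
  moreover have "filterlim (\<lambda>N. real N * (2 * pi)) at_top sequentially"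
    using filterlim_tendsto_pos_mult_at_top[OF tendsto_const _ filterlim_real_sequentially, of "2 * pi"]
    by (simp add: mult.commute)
  ultimately have "I \<longlonglongrightarrow> (LINT \<xi>|lborel. E \<xi>)"
    using integral_symmetric_tendsto[OF E_int] by presburger
  with IJ have "(LINT \<xi>|lborel. E \<xi>) = J"
    using LIMSEQ_unique by blast
  also have "J = (if j = 0 then of_real (2 * pi) else 0)"
    using integral_unique[OF J] integral_exp_period[of j] by (simp add: e_def[abs_def])
  finally show ?thesis
    by (simp add: spline_G E_def[abs_def] e_def)
qed

end

subsection \<open>The sampling theorem\<close>

theorem theorem15:
  fixes I :: "real set" and \<phi> :: "int \<Rightarrow> real \<Rightarrow> complex" and a \<sigma> :: real
  defines "L \<equiv> fundamental_spline a \<sigma>"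
    and "K \<equiv> spline_operator a \<sigma> I \<phi>"
    and "H \<equiv> spline_space a \<sigma> I \<phi>"
    and "ipH \<equiv> spline_inner a \<sigma> I \<phi>"
  assumes "I \<noteq> {}" and "I \<in> sets lebesgue"
    and "orthonormal_basis (l2_space I) (l2_inner I) \<phi>"
    and "a > 0" and "admissible a \<sigma>"
    and L_exists: "\<And>x. integrable lborel (spline_integrand a \<sigma> x)"
  shows "(\<forall>t. AE x in lebesgue_on I. (\<lambda>k. L (t - of_int k) * cnj (\<phi> k x)) summable_on UNIV) \<and>
     (\<forall>f\<in>l2_space I. \<forall>t. integrable (lebesgue_on I) (\<lambda>x. f x * spline_kernel a \<sigma> \<phi> x t)) \<and>
     (\<forall>f\<in>l2_space I. \<forall>g\<in>l2_space I. K f = K g \<longrightarrow> (AE x in lebesgue_on I. f x = g x)) \<and>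
     (\<forall>f\<in>l2_space I. \<forall>t. ((\<lambda>k. l2_inner I f (\<phi> k) * L (t - of_int k)) has_sum K f t) UNIV) \<and>
     (\<forall>f\<in>l2_space I.
        ((\<lambda>A. ip_norm ipH (\<lambda>t. K f t - (\<Sum>k\<in>A. l2_inner I f (\<phi> k) * L (t - of_int k)))) \<longlongrightarrow> 0)
        (finite_subsets_at_top UNIV)) \<and>
     (\<forall>f\<in>l2_space I. \<forall>g\<in>l2_space I. ipH (K f) (K g) = l2_inner I f g) \<and>
     (hilbert_function_space H ipH) \<and>
     (orthonormal_basis H ipH (\<lambda>k t. L (t - of_int k))) \<and>
     (\<forall>f\<in>H. \<forall>t. (\<lambda>k::int. norm (f (of_int k) * L (t - of_int k))) summable_on UNIV) \<and>
     (\<forall>f\<in>H. \<forall>S. uniform_limit S (\<lambda>A t. \<Sum>k\<in>A. f (of_int k) * L (t - of_int k)) f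
        (finite_subsets_at_top (UNIV :: int set)))"
proof -
  \<comment> \<open>The lower bound in the admissibility condition is at least
    \<open>1 / 2 + sqrt 2\<close>, which gives the convergence condition \<open>\<sigma> > 1\<close>
    of the Hurwitz series.\<close>
  have "sqrt 2 \<le> sqrt 2 * sqrt (1 + a^2 / (4 * pi^2) + a^4 / (16 * pi^4))"
    by (simp add: mult_le_cancel_left1)
  moreover have "1 < sqrt 2"
    by simp
  ultimately have "\<sigma> > 1"
    using \<open>admissible a \<sigma>\<close> unfolding admissible_def by linarith
  then interpret int: integrable_spline a \<sigma>
    using \<open>a > 0\<close> L_exists by unfold_locales
  obtain M where M: "\<And>t. (\<lambda>k. norm (fundamental_spline a \<sigma> (t - of_int k))) summable_on UNIV"
    "\<And>t. (\<Sum>\<^sub>\<infinity>k. norm (fundamental_spline a \<sigma> (t - of_int k))) \<le> M"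
    using int.spline_translates_bounded by blast
  interpret spline_sampling a \<sigma> I \<phi> M
    by unfold_locales (use assms(7) int.spline_interpolates M in auto)
  have summable: "AE x in lebesgue_on I. (\<lambda>k. fundamental_spline a \<sigma> (t - of_int k) * cnj (\<phi> k x)) summable_on UNIV" for t
    using AE_kernel_abs_summable[of t] by eventually_elim (rule abs_summable_summable)
  show ?thesis
    unfolding assms(1-4)
    by (intro conjI allI ballI impI summable integrable_kernel operator_inj operator_has_sum
        operator_expansion_converges ipH_operator hilbert_H basis_H samples_abs_summable samples_uniform_limit)
qed

end
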